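(* Let $X$ be a Banach space over $\mathbb K\in\{\mathbb R,\mathbb C\}$ with the Daugavet property, let $n\geqslant 1$, let $f_1,\dots,f_n\in X^*$ be linearly independent, and put \[ Y:=\bigcap_{j=1}^n \ker f_j,\qquad W:=\operatorname{span}\{f_1,\dots,f_n\}. \] Then \[ \lambda(Y,X)=1+\lambda(W,X^* ). \] Moreover, the following are equivalent. (i) There exists a minimal projection $P\colon X\to Y$. (ii) There exists a weak$^*$-continuous minimal projection $Q\colon X^*\to W$. The minimal projections $P$ from $X$ onto $Y$ correspond exactly (one-to-one) to the weak$^*$-continuous minimal projections $Q$ from $X^*$ onto $W$, the correspondence being given by \[ Q=(\mathrm{Id}_X-P)^*. \]
   Context: Projections are bounded linear operators. For a closed subspace $E$ of a Banach space $F$, the projection constant of $E$ in $F$ is $\lambda(E,F)=\inf\{\|P\| : P\colon F\to E \text{ bounded linear},\ P|_E=\mathrm{Id}_E\}$. A minimal projection from $F$ onto $E$ is a projection $P\colon F\to E$ (that is, $P|_E=\mathrm{Id}_E$) with $\|P\|=\lambda(E,F)$. A Banach space $X$ has the Daugavet property if every bounded rank-one operator $T\colon X\to X$ satisfies $\|\mathrm{Id}_X+T\|=1+\|T\|$. "Weak$^*$-continuous" for an operator $X^*\to W\subset X^*$, with $W$ finite-dimensional, means continuous from the weak$^*$ topology $\sigma(X^*,X)$ on $X^*$ to the (unique Hausdorff vector space) topology of $W$. *)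

theory Defs
  imports "HOL-Analysis.Analysis"
begin

text \<open>The class of scalar fields: the normed fields isometrically isomorphic to \<open>\<real>\<close> or \<open>\<complex>\<close>.\<close>

class real_or_complex = real_normed_field +
  assumes real_or_complex:
    "(\<exists>\<phi> :: 'a \<Rightarrow> real. bij \<phi> \<and> (\<forall>x y. \<phi> (x + y) = \<phi> x + \<phi> y) \<and>
        (\<forall>x y. \<phi> (x * y) = \<phi> x * \<phi> y) \<and> (\<forall>x. norm (\<phi> x) = norm x)) \<or>
     (\<exists>\<phi> :: 'a \<Rightarrow> complex. bij \<phi> \<and> (\<forall>x y. \<phi> (x + y) = \<phi> x + \<phi> y) \<and>
        (\<forall>x y. \<phi> (x * y) = \<phi> x * \<phi> y) \<and> (\<forall>x. norm (\<phi> x) = norm x))"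

instance real :: real_or_complex
  by standard (rule disjI1, rule exI[of _ id], simp)

instance complex :: real_or_complex
  by standard (rule disjI2, rule exI[of _ id], simp)

text \<open>
  A normed space over \<open>'k\<close> is a type of class \<^class>\<open>real_normed_vector\<close> (\<^class>\<open>banach\<close> for a
  Banach space) together with a scalar multiplication by \<open>'k\<close> that is compatible with the norm
  and extends the real scalar multiplication of the type.\<close>

locale normed_space_over = vector_space smul
  for smul :: "'k::real_or_complex \<Rightarrow> 'a::real_normed_vector \<Rightarrow> 'a" +
  assumes norm_smul: "norm (smul c x) = norm c * norm x"
    and smul_of_real: "smul (of_real r) x = r *\<^sub>R x"

text \<open>
  \<^typ>\<open>'a \<Rightarrow>\<^sub>L 'k\<close> consists of the bounded \<^emph>\<open>real-linear\<close> maps, with the operator norm. The dual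
  space over \<open>'k\<close> is the subspace of its \<open>'k\<close>-linear elements; the scalars act by
  \<open>(c f)(x) = c f(x)\<close>.\<close>

definition dual_space :: "('k::real_or_complex \<Rightarrow> 'a::real_normed_vector \<Rightarrow> 'a) \<Rightarrow> ('a \<Rightarrow>\<^sub>L 'k) set" where
  "dual_space smul = {f. Vector_Spaces.linear smul (*) (blinfun_apply f)}"

definition dual_smul :: "'k::real_or_complex \<Rightarrow> ('a::real_normed_vector \<Rightarrow>\<^sub>L 'k) \<Rightarrow> ('a \<Rightarrow>\<^sub>L 'k)" where
  "dual_smul c f = blinfun_mult_right c o\<^sub>L f"

lemma dual_smul_apply [simp]: "blinfun_apply (dual_smul c f) x = c * blinfun_apply f x"
  by (simp add: dual_smul_def)

lemma norm_dual_smul: "norm (dual_smul c f) = norm c * norm f"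
proof (rule antisym)
  show "norm (dual_smul c f) \<le> norm c * norm f"
    by (rule norm_blinfun_bound)
       (auto simp: norm_mult mult.assoc intro!: mult_left_mono norm_blinfun)
  show "norm c * norm f \<le> norm (dual_smul c f)"
  proof (cases "c = 0")
    case False
    have "norm f \<le> norm (dual_smul c f) / norm c"
    proof (rule norm_blinfun_bound)
      fix x
      show "norm (blinfun_apply f x) \<le> norm (dual_smul c f) / norm c * norm x"
        using norm_blinfun[of "dual_smul c f" x] False
        by (simp add: norm_mult field_simps)
    qed simp
    then show ?thesis using False by (simp add: field_simps)
  qed simp
qed

interpretation dual: normed_space_over dual_smul
  by unfold_locales
     (auto simp: blinfun_eqI algebra_simps plus_blinfun.rep_eq scaleR_blinfun.rep_eq
        norm_dual_smul scaleR_conv_of_real intro!: blinfun_eqI)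

lemma subspace_dual_space:
  fixes smul :: "'k::real_or_complex \<Rightarrow> 'a::real_normed_vector \<Rightarrow> 'a"
  assumes "normed_space_over smul"
  shows "dual.subspace (dual_space smul)"
proof -
  interpret normed_space_over smul by fact
  have K: "vector_space ((*) :: 'k \<Rightarrow> 'k \<Rightarrow> 'k)"
    by unfold_locales (auto simp: algebra_simps)
  have "Vector_Spaces.linear smul (*) g \<longleftrightarrow>
      (\<forall>x y. g (x + y) = g x + g y) \<and> (\<forall>c x. g (smul c x) = c * g x)" for g :: "'a \<Rightarrow> 'k"
    using vector_space_axioms K by (simp add: Vector_Spaces.linear_iff)
  then show ?thesis
    unfolding dual.subspace_def dual_space_def mem_Collect_eq
    by (simp add: plus_blinfun.rep_eq algebra_simps)
qed

definition weak_star_topology ::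
    "('k::real_or_complex \<Rightarrow> 'a::real_normed_vector \<Rightarrow> 'a) \<Rightarrow> ('a \<Rightarrow>\<^sub>L 'k) topology" where
  \<comment> \<open>\<^const>\<open>euclidean\<close> on \<^typ>\<open>'a \<Rightarrow> 'k\<close> is the topology of pointwise convergence.\<close>
  "weak_star_topology smul = pullback_topology (dual_space smul) blinfun_apply euclidean"

text \<open>
  Subspaces of normed spaces, such as the dual space, are sets \<open>F\<close>. Operators with domain \<open>F\<close> are
  functions that are \<^const>\<open>undefined\<close> outside \<open>F\<close>, so that two of them are equal iff they agree
  on \<open>F\<close>.\<close>

definition bounded_operator_on ::
    "('k \<Rightarrow> 'a::real_normed_vector \<Rightarrow> 'a) \<Rightarrow> 'a set \<Rightarrow> ('a \<Rightarrow> 'a) \<Rightarrow> bool" where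
  "bounded_operator_on smul F T \<longleftrightarrow>
     (\<forall>x\<in>F. \<forall>y\<in>F. T (x + y) = T x + T y) \<and>
     (\<forall>c. \<forall>x\<in>F. T (smul c x) = smul c (T x)) \<and>
     (\<exists>B. \<forall>x\<in>F. norm (T x) \<le> B * norm x)"

definition opnorm_on :: "'a::real_normed_vector set \<Rightarrow> ('a \<Rightarrow> 'a) \<Rightarrow> real" where
  "opnorm_on F T = (SUP x\<in>{x\<in>F. norm x \<le> 1}. norm (T x))"

definition projection_onto ::
    "('k \<Rightarrow> 'a::real_normed_vector \<Rightarrow> 'a) \<Rightarrow> 'a set \<Rightarrow> 'a set \<Rightarrow> ('a \<Rightarrow> 'a) \<Rightarrow> bool" where
  "projection_onto smul E F P \<longleftrightarrow>
     P \<in> F \<rightarrow>\<^sub>E E \<and> bounded_operator_on smul F P \<and> (\<forall>x\<in>E. P x = x)"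

definition projection_constant ::
    "('k \<Rightarrow> 'a::real_normed_vector \<Rightarrow> 'a) \<Rightarrow> 'a set \<Rightarrow> 'a set \<Rightarrow> ereal" where
  \<comment> \<open>Extended real, so that the infimum is \<open>\<infinity>\<close> if there is no bounded projection.\<close>
  "projection_constant smul E F = (INF P\<in>{P. projection_onto smul E F P}. ereal (opnorm_on F P))"

definition minimal_projection ::
    "('k \<Rightarrow> 'a::real_normed_vector \<Rightarrow> 'a) \<Rightarrow> 'a set \<Rightarrow> 'a set \<Rightarrow> ('a \<Rightarrow> 'a) \<Rightarrow> bool" where
  "minimal_projection smul E F P \<longleftrightarrow>
     projection_onto smul E F P \<and> ereal (opnorm_on F P) = projection_constant smul E F"

definition daugavet_property :: "('k::real_or_complex \<Rightarrow> 'a::real_normed_vector \<Rightarrow> 'a) \<Rightarrow> bool" where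
  "daugavet_property smul \<longleftrightarrow>
     (\<forall>T :: 'a \<Rightarrow>\<^sub>L 'a. Vector_Spaces.linear smul smul (blinfun_apply T) \<longrightarrow>
        vector_space.dim smul (range (blinfun_apply T)) = 1 \<longrightarrow>
        norm (id_blinfun + T) = 1 + norm T)"

text \<open>The adjoint \<open>T\<^sup>* f = f \<circ> T\<close> of an operator \<open>T\<close> on the whole space, as an operator on the dual space.\<close>

definition adjoint_operator ::
    "('k::real_or_complex \<Rightarrow> 'a::real_normed_vector \<Rightarrow> 'a) \<Rightarrow> ('a \<Rightarrow> 'a) \<Rightarrow> ('a \<Rightarrow>\<^sub>L 'k) \<Rightarrow> ('a \<Rightarrow>\<^sub>L 'k)" where
  "adjoint_operator smul T = (\<lambda>f\<in>dual_space smul. Blinfun (\<lambda>x. blinfun_apply f (T x)))"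

lemma adjoint_operator_apply:
  assumes "normed_space_over smul" "bounded_operator_on smul UNIV T" "f \<in> dual_space smul"
  shows "blinfun_apply (adjoint_operator smul T f) x = blinfun_apply f (T x)"
proof -
  interpret normed_space_over smul by fact
  obtain B where B: "\<And>x. norm (T x) \<le> B * norm x"
    using assms(2) by (auto simp: bounded_operator_on_def)
  have "bounded_linear T"
  proof (rule bounded_linear_intro)
    fix x y r
    show "T (x + y) = T x + T y" "T (r *\<^sub>R x) = r *\<^sub>R T x"
      using assms(2) by (auto simp: bounded_operator_on_def simp flip: smul_of_real)
    show "norm (T x) \<le> norm x * B"
      using B by (simp add: mult.commute)
  qed
  then have "bounded_linear (\<lambda>x. blinfun_apply f (T x))"
    by (rule bounded_linear_compose[OF blinfun.bounded_linear_right])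
  then show ?thesis using assms(3)
    by (simp add: adjoint_operator_def bounded_linear_Blinfun_apply)
qed

end

theory Submission
  imports Defs
begin

text \<open>
  Every projection \<open>P\<close> onto \<open>Y\<close> is \<open>Id - F\<close>, where the finite-rank operator \<open>F\<close> vanishes on \<open>Y\<close>
  and satisfies \<open>f\<^sub>j (F x) = f\<^sub>j x\<close>. Two facts turn the problem into one about \<open>F\<close>. On a Daugavet
  space \<open>\<parallel>Id + T\<parallel> = 1 + \<parallel>T\<parallel>\<close> holds for all \<open>T\<close> of finite rank (\<open>daugavet_finite_rank\<close>), so
  \<open>\<parallel>P\<parallel> = 1 + \<parallel>F\<parallel>\<close>. The adjoint \<open>Q = F\<^sup>*\<close> is a projection of the dual space onto \<open>W\<close> with
  \<open>\<parallel>Q\<parallel> = \<parallel>F\<parallel>\<close>; the projections arising in this way are exactly the weak*-continuous ones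
  (\<open>weak_star_continuous_projection_is_adjoint\<close>), because a weak*-continuous functional is
  evaluation at a point. Hence \<open>P \<mapsto> (Id - P)\<^sup>*\<close> is a bijection from the projections onto \<open>Y\<close> to
  the weak*-continuous projections onto \<open>W\<close>, and it lowers the norm by exactly 1.

  It remains to see that weak*-continuous projections come as close to \<open>\<lambda>(W, X\<^sup>*)\<close> as arbitrary
  ones (\<open>local_reflexivity_for_projections\<close>). Given any projection \<open>Q\<close> onto \<open>W\<close>, fix a finite set
  of points \<open>x\<^sub>k\<close> of the unit ball of \<open>X\<close> on which the norm of every \<open>F\<close> as above can be read off
  up to a factor close to 1. The admissible \<open>F\<close> form an affine space, and if all of them had
  \<open>max\<^sub>k \<parallel>F x\<^sub>k\<parallel> \<ge> d\<close>, Hahn-Banach would give functionals \<open>g\<^sub>k\<close> with \<open>\<Sum>\<parallel>g\<^sub>k\<parallel> \<le> 1\<close> for which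
  \<open>Re \<Sum> g\<^sub>k (F x\<^sub>k) \<ge> d\<close> does not depend on \<open>F\<close>. This independence places certain combinations of
  the \<open>g\<^sub>k\<close> in \<open>W\<close>, where \<open>Q\<close> is the identity; therefore the sum equals \<open>\<Sum> (Q g\<^sub>k)(x\<^sub>k)\<close>, and
  \<open>d \<le> \<parallel>Q\<parallel>\<close>.

  The finite-rank Daugavet equation is obtained from the rank-one case through slices of the unit
  ball (\<open>daugavet_slice\<close>): for a suitable functional \<open>g\<close>, the operator \<open>T\<close> is close to a fixed vector
  of almost maximal norm on the part of the ball where \<open>g\<close> is nearly maximal
  (\<open>strongly_exposing_functional\<close>).\<close>

section \<open>The scalar field\<close>

text \<open>
  The real part, by polarisation: \<open>\<bar>c + 1\<bar>\<^sup>2 = \<bar>c\<bar>\<^sup>2 + 2 Re c + 1\<close>. Defined in this way it refers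
  to no isomorphism with \<open>\<real>\<close> or \<open>\<complex>\<close>.\<close>

definition re :: "'k::real_or_complex \<Rightarrow> real" where
  "re c = ((norm (c + 1))\<^sup>2 - (norm c)\<^sup>2 - 1) / 2"

text \<open>
  The value 0 over the reals lets one formula express a scalar through the real parts of \<open>c\<close> and
  \<open>i c\<close> in both cases, and the same for a functional and its real part.\<close>

definition imag_unit :: "'k::real_or_complex" where
  "imag_unit = (if \<exists>i::'k. i * i = -1 then SOME i. i * i = -1 else 0)"

text \<open>
  The rules through which all later arguments treat the two fields uniformly; only their proof
  looks at the isomorphism.\<close>

lemma scalar_structure:
  fixes c c' :: "'k::real_or_complex"
  shows re_add: "re (c + c') = re c + re c'"
    and re_of_real_mult: "re (of_real r * c) = r * re c"
    and re_of_real: "re (of_real r :: 'k) = r"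
    and abs_re_le: "\<bar>re c\<bar> \<le> norm c"
    and scalar_decomposition: "c = of_real (re c) - imag_unit * of_real (re (imag_unit * c))"
    and re_imag_unit_mult: "re (imag_unit * of_real r :: 'k) = 0"
    and imag_unit_square: "(imag_unit :: 'k) = 0 \<or> (imag_unit :: 'k) * imag_unit = -1"
proof -
  consider (real) "\<exists>\<phi> :: 'k \<Rightarrow> real. bij \<phi> \<and> (\<forall>x y. \<phi> (x + y) = \<phi> x + \<phi> y) \<and>
        (\<forall>x y. \<phi> (x * y) = \<phi> x * \<phi> y) \<and> (\<forall>x. norm (\<phi> x) = norm x)"
    | (complex) "\<exists>\<phi> :: 'k \<Rightarrow> complex. bij \<phi> \<and> (\<forall>x y. \<phi> (x + y) = \<phi> x + \<phi> y) \<and>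
        (\<forall>x y. \<phi> (x * y) = \<phi> x * \<phi> y) \<and> (\<forall>x. norm (\<phi> x) = norm x)"
    using real_or_complex by blast
  then have "re (c + c') = re c + re c' \<and> re (of_real r * c) = r * re c \<and> re (of_real r :: 'k) = r \<and>
    \<bar>re c\<bar> \<le> norm c \<and> c = of_real (re c) - imag_unit * of_real (re (imag_unit * c)) \<and>
    re (imag_unit * of_real r :: 'k) = 0 \<and>
    ((imag_unit :: 'k) = 0 \<or> (imag_unit :: 'k) * imag_unit = -1)"
  proof cases
    case real
    then obtain \<phi> :: "'k \<Rightarrow> real" where \<phi>: "bij \<phi>" "\<And>x y. \<phi> (x + y) = \<phi> x + \<phi> y"
      "\<And>x y. \<phi> (x * y) = \<phi> x * \<phi> y" "\<And>x. norm (\<phi> x) = norm x" by blast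
    have inj: "x = y" if "\<phi> x = \<phi> y" for x y using \<phi>(1) that by (auto simp: bij_def inj_def)
    have \<phi>0: "\<phi> 0 = 0" using \<phi>(4)[of 0] by simp
    have \<phi>1: "\<phi> 1 = 1" using \<phi>(3)[of 1 1] inj[of 1 0] \<phi>0 by auto
    have re: "re x = \<phi> x" for x
    proof -
      have "(norm (x + 1))\<^sup>2 = (\<phi> x + 1)\<^sup>2" "(norm x)\<^sup>2 = (\<phi> x)\<^sup>2"
        using \<phi>(4)[of "x + 1"] \<phi>(4)[of x] by (simp_all add: \<phi>(2) \<phi>1 flip: \<phi>(4))
      then show ?thesis by (simp add: re_def power2_eq_square algebra_simps)
    qed
    have real: "re (of_real r :: 'k) = r" for r
    proof -
      have "norm (of_real r + 1 :: 'k) = \<bar>r + 1\<bar>" by (metis norm_of_real of_real_1 of_real_add)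
      then show ?thesis by (simp add: re_def power2_eq_square algebra_simps)
    qed
    have neg: "\<phi> (-1) = -1" using \<phi>(2)[of 1 "-1"] \<phi>0 \<phi>1 by simp
    have "i * i \<noteq> -1" for i :: 'k
    proof
      assume "i * i = -1"
      then have "\<phi> i * \<phi> i = -1" using \<phi>(3)[of i i] neg by simp
      then show False by (metis not_one_le_zero neg_0_le_iff_le zero_le_square)
    qed
    then have i0: "(imag_unit :: 'k) = 0" by (simp add: imag_unit_def)
    have "c = of_real (re c)" by (rule inj) (use real re in metis)
    with i0 \<phi>(4)[of c] real show ?thesis by (auto simp: re \<phi> \<phi>0)
  next
    case complex
    then obtain \<phi> :: "'k \<Rightarrow> complex" where \<phi>: "bij \<phi>" "\<And>x y. \<phi> (x + y) = \<phi> x + \<phi> y"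
      "\<And>x y. \<phi> (x * y) = \<phi> x * \<phi> y" "\<And>x. norm (\<phi> x) = norm x" by blast
    have inj: "x = y" if "\<phi> x = \<phi> y" for x y using \<phi>(1) that by (auto simp: bij_def inj_def)
    have \<phi>0: "\<phi> 0 = 0" using \<phi>(4)[of 0] by simp
    have \<phi>1: "\<phi> 1 = 1" using \<phi>(3)[of 1 1] inj[of 1 0] \<phi>0 by auto
    have neg: "\<phi> (- x) = - \<phi> x" for x
      using \<phi>(2)[of x "-x"] \<phi>0 by (simp add: eq_neg_iff_add_eq_0 add.commute)
    have diff: "\<phi> (x - y) = \<phi> x - \<phi> y" for x y
      using \<phi>(2)[of x "-y"] neg[of y] by simp
    have re: "re x = Re (\<phi> x)" for x
    proof -
      have "norm (x + 1) = cmod (\<phi> x + 1)" "norm x = cmod (\<phi> x)"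
        by (simp_all add: \<phi>(2) \<phi>1 flip: \<phi>(4))
      then show ?thesis by (simp add: re_def cmod_power2) (simp add: power2_eq_square algebra_simps)
    qed
    have real: "re (of_real r :: 'k) = r" for r
    proof -
      have "norm (of_real r + 1 :: 'k) = \<bar>r + 1\<bar>" by (metis norm_of_real of_real_1 of_real_add)
      then show ?thesis by (simp add: re_def power2_eq_square algebra_simps)
    qed
    \<comment> \<open>\<open>\<phi>\<close> preserves the modulus and the real part of \<open>of_real r\<close>, so the imaginary part vanishes.\<close>
    have \<phi>_real: "\<phi> (of_real r) = of_real r" for r
    proof -
      have "Re (\<phi> (of_real r)) = r" using real re by metis
      moreover have "(cmod (\<phi> (of_real r)))\<^sup>2 = r\<^sup>2" by (simp add: \<phi>(4))
      ultimately show ?thesis by (simp add: cmod_power2 complex_eq_iff)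
    qed
    obtain j where "\<phi> j = \<i>" using \<phi>(1) by (metis bij_pointE)
    then have "j * j = -1" by (intro inj) (simp add: \<phi>(3) neg \<phi>1)
    then have ex: "\<exists>i::'k. i * i = -1" by blast
    have ii: "(imag_unit :: 'k) * imag_unit = -1"
      unfolding imag_unit_def using someI_ex[OF ex] ex by simp
    have "\<phi> imag_unit * \<phi> imag_unit = -1" using \<phi>(3)[of imag_unit imag_unit] by (simp add: ii neg \<phi>1)
    then have "(\<phi> imag_unit - \<i>) * (\<phi> imag_unit + \<i>) = 0" by (simp add: algebra_simps)
    then have unit: "\<phi> imag_unit = \<i> \<or> \<phi> imag_unit = - \<i>"
      by (auto simp: add_eq_0_iff2)
    have im: "Re (\<phi> imag_unit * of_real r) = 0" using unit by auto
    have dec: "\<phi> c = \<phi> (of_real (re c) - imag_unit * of_real (re (imag_unit * c)))"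
      using unit by (auto simp: diff \<phi>(3) \<phi>_real re complex_eq_iff)
    have "re (c + c') = re c + re c'" "re (of_real r * c) = r * re c" "\<bar>re c\<bar> \<le> norm c"
      "re (imag_unit * of_real r :: 'k) = 0"
      using im abs_Re_le_cmod[of "\<phi> c"] by (simp_all add: re \<phi> \<phi>_real)
    then show ?thesis using ii real inj[OF dec] by blast
  qed
  then show "re (c + c') = re c + re c'" "re (of_real r * c) = r * re c" "re (of_real r :: 'k) = r"
    "\<bar>re c\<bar> \<le> norm c" "c = of_real (re c) - imag_unit * of_real (re (imag_unit * c))"
    "re (imag_unit * of_real r :: 'k) = 0" "(imag_unit :: 'k) = 0 \<or> (imag_unit :: 'k) * imag_unit = -1"
    by blast+
qed

lemma re_minus: "re (a - b) = re a - re b" for a b :: "'k::real_or_complex"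
  using re_add[of "a - b" b] by simp

lemma norm_imag_unit_le: "norm (imag_unit :: 'k::real_or_complex) \<le> 1"
proof -
  have "norm (imag_unit :: 'k) ^ 2 \<le> 1"
    using imag_unit_square[where ?'k = 'k]
    by (auto simp: power2_eq_square simp flip: norm_mult)
  then show ?thesis by (simp add: power_le_one_iff)
qed

lemma unimodular_rotation:
  fixes a :: "'k::real_or_complex"
  obtains \<theta> :: 'k where "norm \<theta> = 1" "\<theta> * a = of_real (norm a)"
proof (cases "a = 0")
  case True
  then show ?thesis using that[of 1] by simp
next
  case False
  then show ?thesis using that[of "of_real (norm a) / a"] by (simp add: norm_divide)
qed

section \<open>The Hahn-Banach theorem\<close>

definition sublinear :: "('v::real_vector \<Rightarrow> real) \<Rightarrow> bool" where
  "sublinear q \<longleftrightarrow> (\<forall>x y. q (x + y) \<le> q x + q y) \<and> (\<forall>t x. 0 \<le> t \<longrightarrow> q (t *\<^sub>R x) = t * q x)"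

lemma sublinearI:
  assumes "\<And>x y. q (x + y) \<le> q x + q y" and "q 0 = 0"
    and "\<And>t x. 0 < t \<Longrightarrow> q (t *\<^sub>R x) \<le> t * q x"
  shows "sublinear q"
  unfolding sublinear_def
proof (intro conjI allI impI)
  fix t :: real and x assume "0 \<le> t"
  show "q (t *\<^sub>R x) = t * q x"
  proof (cases "t = 0")
    case False
    with \<open>0 \<le> t\<close> have t: "0 < t" by simp
    have "q (inverse t *\<^sub>R t *\<^sub>R x) \<le> inverse t * q (t *\<^sub>R x)"
      by (rule assms(3)) (use t in simp)
    with t have "t * q x \<le> q (t *\<^sub>R x)" by (simp add: field_simps)
    with assms(3)[OF t, of x] show ?thesis by simp
  qed (simp add: assms(2))
qed (use assms in auto)

lemma sublinear_0: "sublinear q \<Longrightarrow> q 0 = 0"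
  unfolding sublinear_def by (metis mult_zero_left order_refl scaleR_zero_left)

lemma sublinear_minus_le: "sublinear q \<Longrightarrow> - q (- x) \<le> q x"
  using sublinear_0[of q] unfolding sublinear_def
  by (metis add.right_inverse add_le_same_cancel2 diff_0 diff_le_eq)

text \<open>
  Lowering \<open>q\<close> by a convex cone of demands: a pair \<open>(c, m)\<close> asks every linear functional below the
  new functional \<open>r\<close> to be at least \<open>m\<close> at \<open>c\<close>, since \<open>r (- c) \<le> - m\<close>. The demands are consistent
  as soon as \<open>m \<le> q c\<close>, for then \<open>- q (- x)\<close> bounds the infimum from below. It is used both to
  show that minimal sublinear functionals are linear and to separate a point from a subspace.\<close>

lemma sublinear_inf_cone:
  assumes q: "sublinear q" and C: "convex_cone C" and le: "\<forall>(c, m)\<in>C. m \<le> q c"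
  defines "r \<equiv> \<lambda>x. INF (c, m)\<in>C. q (x + c) - m"
  shows "sublinear r" and "\<And>c m x. (c, m) \<in> C \<Longrightarrow> r x \<le> q (x + c) - m"
proof -
  have C0: "(0, 0) \<in> C" using convex_cone_contains_0[OF C] by (simp add: zero_prod_def)
  have add: "(c + c', m + m') \<in> C" if "(c, m) \<in> C" "(c', m') \<in> C" for c m c' m'
    using convex_cone_add[OF C that] by simp
  have scale: "(t *\<^sub>R c, t * m) \<in> C" if "0 < t" "(c, m) \<in> C" for t c m
    using convex_cone_scaleR[OF C _ that(2), of t] that(1) by simp
  have qadd: "q (x + y) \<le> q x + q y" and qscale: "0 \<le> t \<Longrightarrow> q (t *\<^sub>R x) = t * q x" for x y t
    using q by (auto simp: sublinear_def)
  have lower: "- q (- x) \<le> q (x + c) - m" if "(c, m) \<in> C" for x c m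
    using qadd[of "- x" "x + c"] le that by fastforce
  have bdd: "bdd_below ((\<lambda>(c, m). q (x + c) - m) ` C)" for x
    using lower by (intro bdd_belowI[of _ "- q (- x)"]) auto
  show r_le: "r x \<le> q (x + c) - m" if "(c, m) \<in> C" for c m x
    unfolding r_def using cINF_lower[OF bdd that] by simp
  have r_ge: "a \<le> r x" if "\<And>c m. (c, m) \<in> C \<Longrightarrow> a \<le> q (x + c) - m" for a x
    unfolding r_def by (rule cINF_greatest) (use C0 that in auto)
  show "sublinear r"
  proof (rule sublinearI)
    fix x y
    have 1: "r (x + y) \<le> (q (x + c) - m) + (q (y + c') - m')"
      if "(c, m) \<in> C" "(c', m') \<in> C" for c m c' m'
    proof -
      have "r (x + y) \<le> q (x + y + (c + c')) - (m + m')"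
        by (rule r_le[OF add[OF that]])
      also have "\<dots> \<le> q (x + c) + q (y + c') - (m + m')"
        using qadd[of "x + c" "y + c'"] by (simp add: algebra_simps)
      finally show ?thesis by simp
    qed
    have "r (x + y) - (q (x + c) - m) \<le> r y" if "(c, m) \<in> C" for c m
      by (rule r_ge) (use 1[OF that] in \<open>simp add: algebra_simps\<close>)
    then have "r (x + y) - r y \<le> r x"
      by (intro r_ge) (simp add: algebra_simps)
    then show "r (x + y) \<le> r x + r y" by simp
  next
    have "r 0 \<le> 0" using r_le[OF C0, of 0] sublinear_0[OF q] by simp
    moreover have "0 \<le> r 0" by (rule r_ge) (use le in auto)
    ultimately show "r 0 = 0" by simp
  next
    fix t :: real and x assume t: "0 < t"
    have "r (t *\<^sub>R x) / t \<le> r x"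
    proof (rule r_ge)
      fix c m assume c: "(c, m) \<in> C"
      have "r (t *\<^sub>R x) \<le> q (t *\<^sub>R x + t *\<^sub>R c) - t * m"
        by (rule r_le[OF scale[OF t c]])
      also have "\<dots> = t * (q (x + c) - m)"
        using qscale[of t "x + c"] t by (simp add: algebra_simps)
      finally show "r (t *\<^sub>R x) / t \<le> q (x + c) - m"
        using t by (simp add: field_simps)
    qed
    then show "r (t *\<^sub>R x) \<le> t * r x" using t by (simp add: field_simps)
  qed
qed

text \<open>
  Zorn's lemma for the reversed pointwise order. A chain below \<open>p\<close> has a pointwise infimum because
  sublinearity keeps its members above \<open>x \<mapsto> - p (- x)\<close>.\<close>

lemma minimal_sublinear_exists:
  assumes p: "sublinear p"
  obtains q where "sublinear q" "q \<le> p" "\<And>r. sublinear r \<Longrightarrow> r \<le> q \<Longrightarrow> r = q"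
proof -
  define A where "A = {q. sublinear q \<and> q \<le> p}"
  define R where "R = relation_of (\<lambda>q r. r \<le> q) A"
  have po: "partial_order_on A R"
    unfolding R_def by (rule partial_order_on_relation_ofI) auto
  have "\<exists>u\<in>A. \<forall>q\<in>C. u \<le> q" if C: "C \<in> Chains R" for C
  proof (cases "C = {}")
    case True
    then show ?thesis using p by (auto simp: A_def)
  next
    case False
    have CA: "C \<subseteq> A" and chain: "\<And>q r. q \<in> C \<Longrightarrow> r \<in> C \<Longrightarrow> q \<le> r \<or> r \<le> q"
      using C unfolding Chains_def R_def relation_of_def by auto
    have lower: "- p (- x) \<le> q x" if "q \<in> C" for q x
    proof -
      have "sublinear q" "q (- x) \<le> p (- x)" using CA that by (auto simp: A_def le_fun_def)
      then show ?thesis using sublinear_minus_le[of q x] by linarith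
    qed
    have bdd: "bdd_below ((\<lambda>q. q x) ` C)" for x
      using lower by (intro bdd_belowI[of _ "- p (- x)"]) auto
    define u where "u = (\<lambda>x. INF q\<in>C. q x)"
    have u_le: "u x \<le> q x" if "q \<in> C" for q x
      unfolding u_def by (rule cINF_lower[OF bdd that])
    have u_ge: "a \<le> u x" if "\<And>q. q \<in> C \<Longrightarrow> a \<le> q x" for a x
      unfolding u_def by (rule cINF_greatest[OF False]) (use that in auto)
    have sub: "sublinear q" if "q \<in> C" for q using that CA by (auto simp: A_def)
    have "sublinear u"
    proof (rule sublinearI)
      fix x y
      \<comment> \<open>By comparability, \<open>q x + r y\<close> dominates \<open>s x + s y\<close> for the smaller \<open>s\<close> of \<open>q\<close> and \<open>r\<close>.\<close>
      have 1: "u (x + y) \<le> q x + r y" if qr: "q \<in> C" "r \<in> C" for q r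
      proof -
        obtain s where s: "s \<in> C" "s \<le> q" "s \<le> r"
          using chain[OF qr] qr by blast
        have "u (x + y) \<le> s (x + y)" by (rule u_le[OF s(1)])
        also have "\<dots> \<le> s x + s y" using sub[OF s(1)] by (simp add: sublinear_def)
        also have "\<dots> \<le> q x + r y" using s(2,3) by (intro add_mono) (auto simp: le_fun_def)
        finally show ?thesis .
      qed
      have "u (x + y) - q x \<le> u y" if "q \<in> C" for q
        by (rule u_ge) (use 1[OF that] in \<open>simp add: algebra_simps\<close>)
      then have "u (x + y) - u y \<le> u x" by (intro u_ge) (simp add: algebra_simps)
      then show "u (x + y) \<le> u x + u y" by simp
    next
      obtain q where q: "q \<in> C" using False by blast
      have "u 0 \<le> 0" using u_le[OF q, of 0] sublinear_0[OF sub[OF q]] by simp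
      moreover have "0 \<le> u 0"
        by (rule u_ge) (simp add: sublinear_0[OF sub])
      ultimately show "u 0 = 0" by simp
    next
      fix t :: real and x assume t: "0 < t"
      have "u (t *\<^sub>R x) / t \<le> u x"
      proof (rule u_ge)
        fix q assume "q \<in> C"
        then have "u (t *\<^sub>R x) \<le> t * q x"
          using u_le[of q "t *\<^sub>R x"] sub[of q] t by (simp add: sublinear_def)
        then show "u (t *\<^sub>R x) / t \<le> q x" using t by (simp add: field_simps)
      qed
      then show "u (t *\<^sub>R x) \<le> t * u x" using t by (simp add: field_simps)
    qed
    moreover have "u \<le> p"
    proof -
      obtain q where q: "q \<in> C" using False by blast
      then have "q \<le> p" using CA by (auto simp: A_def)
      then show ?thesis using u_le[OF q] by (auto simp: le_fun_def intro: order_trans)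
    qed
    ultimately have "u \<in> A" by (simp add: A_def)
    then show ?thesis using u_le by (auto simp: le_fun_def)
  qed
  then obtain q where q: "q \<in> A" "\<And>r. r \<in> A \<Longrightarrow> r \<le> q \<Longrightarrow> r = q"
    using predicate_Zorn[OF po[unfolded R_def]] unfolding R_def by blast
  show ?thesis
  proof (rule that)
    show "sublinear q" "q \<le> p" using q(1) by (auto simp: A_def)
    show "r = q" if "sublinear r" "r \<le> q" for r
      using that q by (auto simp: A_def intro: order_trans)
  qed
qed

text \<open>
  A minimal sublinear functional \<open>q\<close> is linear: the demand that a functional attain \<open>q a\<close> at \<open>a\<close>
  cannot lower \<open>q\<close> any further, and this says that \<open>q x + q a \<le> q (x + a)\<close>.\<close>

theorem hahn_banach:
  assumes p: "sublinear p"
  obtains l where "linear l" "\<And>x. l x \<le> p x"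
proof -
  obtain q where q: "sublinear q" "q \<le> p" and min: "\<And>r. sublinear r \<Longrightarrow> r \<le> q \<Longrightarrow> r = q"
    using minimal_sublinear_exists[OF p] by blast
  have qscale: "0 \<le> t \<Longrightarrow> q (t *\<^sub>R x) = t * q x" for t x using q(1) by (simp add: sublinear_def)
  have ge: "q x + q a \<le> q (x + a)" for x a
  proof -
    define C where "C = (\<lambda>t. (t *\<^sub>R a, t * q a)) ` {0..}"
    define r where "r x = (INF (c, m)\<in>C. q (x + c) - m)" for x
    have Ca: "(a, q a) \<in> C" unfolding C_def by (rule image_eqI[of _ _ 1]) auto
    have "linear (\<lambda>t. (t *\<^sub>R a, t * q a))" by (intro linearI) (auto simp: algebra_simps)
    moreover have "convex_cone {0::real..}" by (auto simp: convex_cone_iff)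
    ultimately have C: "convex_cone C" unfolding C_def by (intro convex_cone_linear_image) simp
    have le: "\<forall>(c, m)\<in>C. m \<le> q c" by (auto simp: C_def qscale)
    note cone = sublinear_inf_cone[OF q(1) C le, folded r_def]
    have C0: "(0, 0) \<in> C" using convex_cone_contains_0[OF C] by (simp add: zero_prod_def)
    have "r = q"
      by (rule min) (use cone(1) cone(2)[OF C0] in \<open>auto simp: le_fun_def\<close>)
    then show ?thesis using cone(2)[OF Ca, of x] by simp
  qed
  have add: "q (x + y) = q x + q y" for x y
    using ge[of x y] q(1) by (simp add: sublinear_def order_antisym)
  have "q (r *\<^sub>R x) = r * q x" for r x
  proof (cases "0 \<le> r")
    case False
    have "q (r *\<^sub>R x) + q ((- r) *\<^sub>R x) = 0"
      using add[of "r *\<^sub>R x" "(- r) *\<^sub>R x"] sublinear_0[OF q(1)] by simp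
    then show ?thesis using qscale[of "- r" x] False by simp
  qed (rule qscale)
  then have "linear q" using add by (intro linearI) auto
  then show ?thesis using that q(2) by (auto simp: le_fun_def)
qed

text \<open>
  The demands \<open>t *\<^sub>R e + l\<close> at level \<open>t d\<close>, for \<open>t \<ge> 0\<close>, form a convex cone below the norm precisely because
  \<open>e\<close> has distance at least \<open>d\<close> from \<open>L\<close>. On \<open>L\<close> itself the demand is to be nonnegative, hence zero.\<close>

lemma distance_functional_exists:
  fixes L :: "'v::real_normed_vector set"
  assumes L: "subspace L" and d: "\<And>l. l \<in> L \<Longrightarrow> d \<le> norm (e + l)" and "0 \<le> d"
  obtains \<Lambda> where "linear \<Lambda>" "\<And>x. \<Lambda> x \<le> norm x" "\<And>l. l \<in> L \<Longrightarrow> \<Lambda> l = 0" "d \<le> \<Lambda> e"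
proof -
  have nrm: "sublinear (norm :: 'v \<Rightarrow> real)"
    by (auto simp: sublinear_def norm_triangle_ineq)
  define C where "C = {(t *\<^sub>R e + l, t * d) | t l. 0 \<le> t \<and> l \<in> L}"
  define r where "r x = (INF (c, m)\<in>C. norm (x + c) - m)" for x
  have CI: "(t *\<^sub>R e + l, t * d) \<in> C" if "0 \<le> t" "l \<in> L" for t l
    using that by (auto simp: C_def)
  have Cl: "(l, 0) \<in> C" if "l \<in> L" for l
    using CI[of 0 l] that by simp
  have C0: "(0, 0) \<in> C" using Cl subspace_0[OF L] by blast
  have C: "convex_cone C"
    unfolding convex_cone_iff
  proof (intro conjI ballI allI impI)
    show "0 \<in> C" using C0 by (simp add: zero_prod_def)
    fix z assume "z \<in> C"
    then obtain t l where z: "z = (t *\<^sub>R e + l, t * d)" "0 \<le> t" "l \<in> L" by (auto simp: C_def)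
    show "s *\<^sub>R z \<in> C" if "0 \<le> s" for s
      using CI[of "s * t" "s *\<^sub>R l"] subspace_scale[OF L z(3)] that z
      by (simp add: algebra_simps)
    fix z' assume "z' \<in> C"
    then obtain t' l' where "z' = (t' *\<^sub>R e + l', t' * d)" "0 \<le> t'" "l' \<in> L"
      by (auto simp: C_def)
    then show "z + z' \<in> C" using CI[of "t + t'" "l + l'"] subspace_add[OF L] z
      by (simp add: algebra_simps)
  qed
  have "m \<le> norm c" if "(c, m) \<in> C" for c m
  proof -
    from that obtain t l where c: "c = t *\<^sub>R e + l" "m = t * d" and t: "0 \<le> t" and l: "l \<in> L"
      by (auto simp: C_def)
    show ?thesis
    proof (cases "t = 0")
      case False
      have "d \<le> norm (e + inverse t *\<^sub>R l)" by (rule d) (rule subspace_scale[OF L l])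
      then have "t * d \<le> t * norm (e + inverse t *\<^sub>R l)" using t by (rule mult_left_mono)
      also have "\<dots> = norm (t *\<^sub>R (e + inverse t *\<^sub>R l))" using t by simp
      also have "t *\<^sub>R (e + inverse t *\<^sub>R l) = c" using False by (simp add: c algebra_simps)
      finally show ?thesis by (simp add: c)
    qed (simp add: c)
  qed
  then have le: "\<forall>(c, m)\<in>C. m \<le> norm c" by blast
  note cone = sublinear_inf_cone[OF nrm C le, folded r_def]
  obtain \<Lambda> where \<Lambda>: "linear \<Lambda>" "\<And>x. \<Lambda> x \<le> r x" using hahn_banach[OF cone(1)] by blast
  have neg: "\<Lambda> (- x) = - \<Lambda> x" for x using linear_neg[OF \<Lambda>(1)] by blast
  have Cle: "m \<le> \<Lambda> c" if "(c, m) \<in> C" for c m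
    using \<Lambda>(2)[of "- c"] cone(2)[OF that, of "- c"] by (simp add: neg)
  show ?thesis
  proof (rule that)
    show "linear \<Lambda>" by fact
    show "\<Lambda> x \<le> norm x" for x using \<Lambda>(2)[of x] cone(2)[OF C0, of x] by simp
    show "\<Lambda> l = 0" if "l \<in> L" for l
      using Cle[OF Cl[OF that]] Cle[OF Cl[OF subspace_neg[OF L that]]] by (simp add: neg)
    show "d \<le> \<Lambda> e" using Cle[OF CI[of 1 0]] subspace_0[OF L] by simp
  qed
qed

section \<open>Functionals and operators\<close>

lemma norm_blinfun_le_on_unit_ball:
  fixes A :: "'v::real_normed_vector \<Rightarrow>\<^sub>L 'w::real_normed_vector"
  assumes "\<And>x. norm x \<le> 1 \<Longrightarrow> norm (blinfun_apply A x) \<le> B"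
  shows "norm A \<le> B"
proof (rule norm_blinfun_bound)
  show "0 \<le> B" using assms[of 0] by simp
  show "norm (blinfun_apply A x) \<le> B * norm x" for x
  proof (cases "x = 0")
    case False
    then show ?thesis using assms[of "x /\<^sub>R norm x"]
      by (simp add: blinfun.scaleR_right field_simps)
  qed simp
qed

context normed_space_over begin

lemma in_dual_space_iff:
  "f \<in> dual_space smul \<longleftrightarrow> (\<forall>c x. blinfun_apply f (smul c x) = c * blinfun_apply f x)"
proof -
  have K: "vector_space ((*) :: 'k \<Rightarrow> 'k \<Rightarrow> 'k)"
    by unfold_locales (auto simp: algebra_simps)
  show ?thesis
    using vector_space_axioms K
    by (simp add: Vector_Spaces.linear_iff dual_space_def blinfun.add_right)
qed

lemma dual_apply_smul:
  "f \<in> dual_space smul \<Longrightarrow> blinfun_apply f (smul c x) = c * blinfun_apply f x"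
  by (simp add: in_dual_space_iff)

text \<open>
  The functional is \<open>x \<mapsto> \<psi> x - i \<psi> (i x)\<close>. Its norm is not larger than the bound for \<open>\<psi>\<close>, since a
  unimodular factor makes any of its values real without changing the norm of the argument. This
  reduces extension and separation over either field to the real Hahn-Banach theorem.\<close>

lemma dual_functional_of_real_part:
  assumes "linear \<psi>" and le: "\<And>x. \<psi> x \<le> M * norm x" and "0 \<le> M"
  obtains g where "g \<in> dual_space smul" "\<And>x. re (blinfun_apply g x) = \<psi> x" "norm g \<le> M"
proof -
  note add = linear_add[OF assms(1)] and scale = linear_cmul[OF assms(1)]
    and neg = linear_neg[OF assms(1)]
  define h :: "'a \<Rightarrow> 'k" where "h x = of_real (\<psi> x) - imag_unit * of_real (\<psi> (smul imag_unit x))" for x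
  have h_add: "h (x + y) = h x + h y" for x y
    by (simp add: h_def add scale_right_distrib algebra_simps)
  have comm: "smul c (smul (of_real r) x) = smul (of_real r) (smul c x)" for c r x
    by (simp add: mult.commute)
  have h_real: "h (smul (of_real r) x) = of_real r * h x" for r x
    unfolding h_def comm unfolding smul_of_real by (simp add: scale algebra_simps)
  have h_unit: "h (smul imag_unit x) = imag_unit * h x" for x
    using imag_unit_square
  proof
    assume "(imag_unit :: 'k) = 0"
    then show ?thesis using linear_0[OF assms(1)] by (simp add: h_def)
  next
    assume ii: "(imag_unit :: 'k) * imag_unit = -1"
    have "imag_unit * h x = imag_unit * of_real (\<psi> x) + of_real (\<psi> (smul imag_unit x))"
      using ii by (simp add: h_def right_diff_distrib flip: mult.assoc)
    then show ?thesis using ii by (simp add: h_def neg)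
  qed
  have h_smul: "h (smul c x) = c * h x" for c x
  proof -
    have c: "c = of_real (re c) + of_real (- re (imag_unit * c)) * imag_unit"
      using scalar_decomposition[of c] by (simp add: mult.commute)
    have "h (smul c x) = h (smul (of_real (re c)) x + smul (of_real (- re (imag_unit * c))) (smul imag_unit x))"
      by (subst c) (simp only: scale_left_distrib scale_scale)
    also have "\<dots> = (of_real (re c) + of_real (- re (imag_unit * c)) * imag_unit) * h x"
      by (simp only: h_add h_real h_unit distrib_right mult.assoc)
    finally show ?thesis using c by simp
  qed
  have re_h: "re (h x) = \<psi> x" for x
    by (simp add: h_def re_minus re_of_real re_imag_unit_mult)
  have bound: "norm (h x) \<le> M * norm x" for x
  proof (cases "h x = 0")
    case True
    have "- \<psi> x \<le> M * norm x" using le[of "- x"] by (simp add: neg)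
    with le[of x] True show ?thesis by simp
  next
    case False
    define \<theta> where "\<theta> = of_real (norm (h x)) / h x"
    have "norm \<theta> = 1" "\<theta> * h x = of_real (norm (h x))"
      using False by (simp_all add: \<theta>_def norm_divide)
    then have "norm (h x) = re (h (smul \<theta> x))" by (simp add: h_smul re_of_real)
    also have "\<dots> \<le> M * norm (smul \<theta> x)" unfolding re_h by (rule le)
    finally show ?thesis by (simp add: norm_smul \<open>norm \<theta> = 1\<close>)
  qed
  have blin: "bounded_linear h"
  proof (rule bounded_linear_intro)
    fix x y r
    show "h (x + y) = h x + h y" by (rule h_add)
    show "h (r *\<^sub>R x) = r *\<^sub>R h x" using h_real by (simp add: smul_of_real scaleR_conv_of_real)
    show "norm (h x) \<le> norm x * M" using bound by (simp add: mult.commute)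
  qed
  show ?thesis
  proof (rule that[of "Blinfun h"])
    show "Blinfun h \<in> dual_space smul"
      by (simp add: in_dual_space_iff bounded_linear_Blinfun_apply[OF blin] h_smul)
    show "re (blinfun_apply (Blinfun h) x) = \<psi> x" for x
      by (simp add: bounded_linear_Blinfun_apply[OF blin] re_h)
    show "norm (Blinfun h) \<le> M"
      using bound \<open>0 \<le> M\<close> by (intro norm_blinfun_bound) (auto simp: bounded_linear_Blinfun_apply[OF blin])
  qed
qed
lemma norming_functional_exists:
  obtains g where "g \<in> dual_space smul" "norm g \<le> 1" "norm x \<le> re (blinfun_apply g x)"
proof -
  obtain \<Lambda> where \<Lambda>: "linear \<Lambda>" "\<And>y. \<Lambda> y \<le> norm y" "norm x \<le> \<Lambda> x"
    using distance_functional_exists[of "{0}" "norm x" x] subspace_single_0 by auto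
  obtain g where "g \<in> dual_space smul" "\<And>y. re (blinfun_apply g y) = \<Lambda> y" "norm g \<le> 1"
    using dual_functional_of_real_part[OF \<Lambda>(1), of 1] \<Lambda>(2) by auto
  with \<Lambda>(3) that show ?thesis by metis
qed

lemma dual_space_separates_points:
  assumes "\<And>g. g \<in> dual_space smul \<Longrightarrow> blinfun_apply g x = blinfun_apply g y"
  shows "x = y"
proof -
  obtain g where g: "g \<in> dual_space smul" "norm (x - y) \<le> re (blinfun_apply g (x - y))"
    using norming_functional_exists by blast
  have "blinfun_apply g (x - y) = 0" using assms[OF g(1)] by (simp add: blinfun.diff_right)
  with g(2) abs_re_le[of "blinfun_apply g (x - y)"] show ?thesis by simp
qed

lemma dual_norm_nearly_attained:
  assumes g: "g \<in> dual_space smul" and "0 < \<epsilon>"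
  obtains v where "norm v \<le> 1" "norm g - \<epsilon> \<le> re (blinfun_apply g v)"
proof -
  obtain x where x: "norm x \<le> 1" "norm g - \<epsilon> < norm (blinfun_apply g x)"
  proof (rule ccontr)
    assume no: "\<not> thesis"
    have "norm g \<le> norm g - \<epsilon>"
    proof (rule norm_blinfun_le_on_unit_ball)
      fix x :: 'a assume "norm x \<le> 1"
      then show "norm (blinfun_apply g x) \<le> norm g - \<epsilon>" using no that by force
    qed
    with \<open>0 < \<epsilon>\<close> show False by simp
  qed
  obtain \<theta> where \<theta>: "norm \<theta> = 1" "\<theta> * blinfun_apply g x = of_real (norm (blinfun_apply g x))"
    by (rule unimodular_rotation)
  show ?thesis
    by (rule that[of "smul \<theta> x"])
       (use x \<theta> in \<open>simp_all add: norm_smul dual_apply_smul[OF g] re_of_real\<close>)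
qed

lemma bounded_operator_on_scaleR:
  assumes "bounded_operator_on smul F T" "x \<in> F"
  shows "T (r *\<^sub>R x) = r *\<^sub>R T x"
proof -
  have "T (smul (of_real r) x) = smul (of_real r) (T x)"
    using assms unfolding bounded_operator_on_def by blast
  then show ?thesis by (simp add: smul_of_real)
qed

lemma
  assumes T: "bounded_operator_on smul F T" and F: "subspace F"
  shows norm_le_opnorm_on: "x \<in> F \<Longrightarrow> norm (T x) \<le> opnorm_on F T * norm x"
    and opnorm_on_nonneg: "0 \<le> opnorm_on F T"
proof -
  obtain B where B: "\<And>x. x \<in> F \<Longrightarrow> norm (T x) \<le> B * norm x"
    using T unfolding bounded_operator_on_def by blast
  have bdd: "bdd_above ((\<lambda>x. norm (T x)) ` {x \<in> F. norm x \<le> 1})"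
  proof (rule bdd_aboveI2)
    fix x assume "x \<in> {x \<in> F. norm x \<le> 1}"
    then have x: "x \<in> F" "norm x \<le> 1" by auto
    have "norm (T x) \<le> \<bar>B\<bar> * norm x" by (rule order_trans[OF B[OF x(1)]]) (simp add: mult_right_mono)
    also have "\<dots> \<le> \<bar>B\<bar>" using mult_left_mono[OF x(2), of "\<bar>B\<bar>"] by simp
    finally show "norm (T x) \<le> \<bar>B\<bar>" .
  qed
  have ball: "norm (T x) \<le> opnorm_on F T" if "x \<in> F" "norm x \<le> 1" for x
    unfolding opnorm_on_def by (rule cSUP_upper[OF _ bdd]) (use that in simp)
  show "0 \<le> opnorm_on F T"
    by (rule order_trans[OF norm_ge_zero ball[of 0]]) (simp_all add: subspace_0[OF F])
  show "norm (T x) \<le> opnorm_on F T * norm x" if x: "x \<in> F"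
  proof (cases "x = 0")
    case True
    then show ?thesis using B[OF x] by simp
  next
    case False
    have "x /\<^sub>R norm x \<in> F"
      using subspace_scale[OF F x, of "of_real (inverse (norm x))"] unfolding smul_of_real .
    then have "norm (T (x /\<^sub>R norm x)) \<le> opnorm_on F T"
      by (rule ball) (use False in simp)
    then show ?thesis using False
      by (simp add: bounded_operator_on_scaleR[OF T x] field_simps)
  qed
qed

lemma opnorm_on_le:
  assumes "0 \<in> F" "0 \<le> B" "\<And>x. x \<in> F \<Longrightarrow> norm (T x) \<le> B * norm x"
  shows "opnorm_on F T \<le> B"
  unfolding opnorm_on_def
proof (rule cSUP_least)
  show "{x \<in> F. norm x \<le> 1} \<noteq> {}" using assms(1) by (auto intro!: exI[of _ 0])
  fix x assume "x \<in> {x \<in> F. norm x \<le> 1}"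
  then show "norm (T x) \<le> B"
    using assms(3)[of x] mult_left_mono[of "norm x" 1 B] assms(2) by simp
qed

lemma bounded_linear_of_bounded_operator:
  assumes "bounded_operator_on smul UNIV T"
  shows "bounded_linear T"
proof -
  obtain B where "\<And>x. norm (T x) \<le> B * norm x" using assms by (auto simp: bounded_operator_on_def)
  then show ?thesis using assms bounded_operator_on_scaleR[OF assms]
    by (intro bounded_linear_intro[of _ B]) (auto simp: bounded_operator_on_def mult.commute)
qed

lemma bounded_operator_onI:
  assumes "bounded_linear T" "\<And>c x. T (smul c x) = smul c (T x)"
  shows "bounded_operator_on smul UNIV T"
proof -
  obtain B where "\<And>x. norm (T x) \<le> norm x * B" using bounded_linear.bounded[OF assms(1)] by blast
  then show ?thesis using assms(2) linear_add[OF bounded_linear.linear[OF assms(1)]]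
    by (auto simp: bounded_operator_on_def mult.commute)
qed

lemma bounded_operator_on_UNIV_iff:
  "bounded_operator_on smul UNIV T \<longleftrightarrow> bounded_linear T \<and> (\<forall>c x. T (smul c x) = smul c (T x))"
proof
  assume T: "bounded_operator_on smul UNIV T"
  have "T (smul c x) = smul c (T x)" for c x using T unfolding bounded_operator_on_def by blast
  then show "bounded_linear T \<and> (\<forall>c x. T (smul c x) = smul c (T x))"
    using bounded_linear_of_bounded_operator[OF T] by blast
qed (simp add: bounded_operator_onI)

lemma opnorm_on_UNIV:
  assumes "bounded_operator_on smul UNIV T"
  shows "opnorm_on UNIV T = norm (Blinfun T)"
proof -
  have T: "blinfun_apply (Blinfun T) = T"
    by (rule bounded_linear_Blinfun_apply[OF bounded_linear_of_bounded_operator[OF assms]])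
  show ?thesis
  proof (rule antisym)
    show "opnorm_on UNIV T \<le> norm (Blinfun T)"
      using norm_blinfun[of "Blinfun T"] by (intro opnorm_on_le) (simp_all add: T)
    show "norm (Blinfun T) \<le> opnorm_on UNIV T"
      using norm_le_opnorm_on[OF assms] opnorm_on_nonneg[OF assms]
      by (intro norm_blinfun_bound) (simp_all add: T)
  qed
qed

lemma bounded_linear_smul_left: "bounded_linear (\<lambda>c. smul c x)"
proof (rule bounded_linear_intro)
  show "smul (r *\<^sub>R c) x = r *\<^sub>R smul c x" for r c
    by (simp add: scaleR_conv_of_real flip: smul_of_real)
  show "norm (smul c x) \<le> norm c * norm x" for c by (simp add: norm_smul)
qed (rule scale_left_distrib)

lemma bounded_operator_finite_rank:
  assumes "\<And>j. j \<in> J \<Longrightarrow> f j \<in> dual_space smul"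
  shows "bounded_operator_on smul UNIV (\<lambda>x. \<Sum>j\<in>J. smul (blinfun_apply (f j) x) (u j))"
proof (rule bounded_operator_onI)
  have "bounded_linear (\<lambda>x. smul (blinfun_apply (f j) x) (u j))" for j
    by (rule bounded_linear_compose[OF bounded_linear_smul_left blinfun.bounded_linear_right])
  then show "bounded_linear (\<lambda>x. \<Sum>j\<in>J. smul (blinfun_apply (f j) x) (u j))"
    by (rule bounded_linear_sum)
qed (simp add: scale_sum_right dual_apply_smul assms)

lemma bounded_operator_on_diff:
  assumes "bounded_operator_on smul UNIV S" "bounded_operator_on smul UNIV T"
  shows "bounded_operator_on smul UNIV (\<lambda>x. S x - T x)"
proof (rule bounded_operator_onI)
  show "bounded_linear (\<lambda>x. S x - T x)"
    by (intro bounded_linear_sub bounded_linear_of_bounded_operator assms)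
  show "S (smul c x) - T (smul c x) = smul c (S x - T x)" for c x
    using assms by (simp add: bounded_operator_on_UNIV_iff scale_right_diff_distrib)
qed

lemma bounded_operator_on_id: "bounded_operator_on smul UNIV (\<lambda>x. x)"
  by (rule bounded_operator_onI) (simp_all add: bounded_linear_ident)

lemma adjoint_in_dual_space:
  assumes T: "bounded_operator_on smul UNIV T" and g: "g \<in> dual_space smul"
  shows "adjoint_operator smul T g \<in> dual_space smul"
proof -
  have "T (smul c x) = smul c (T x)" for c x using T unfolding bounded_operator_on_def by blast
  then show ?thesis
    unfolding in_dual_space_iff adjoint_operator_apply[OF normed_space_over_axioms T g]
    by (simp add: dual_apply_smul[OF g])
qed

text \<open>
  The adjoint is not smaller in norm because norming functionals exist.\<close>

lemma
  assumes T: "bounded_operator_on smul UNIV T"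
  shows bounded_operator_on_adjoint:
      "bounded_operator_on dual_smul (dual_space smul) (adjoint_operator smul T)"
    and opnorm_on_adjoint: "opnorm_on (dual_space smul) (adjoint_operator smul T) = opnorm_on UNIV T"
proof -
  let ?D = "dual_space smul" and ?Q = "adjoint_operator smul T"
  note D = subspace_dual_space[OF normed_space_over_axioms]
  note apply_Q = adjoint_operator_apply[OF normed_space_over_axioms T]
  note T0 = opnorm_on_nonneg[OF T subspace_UNIV]
  have Q_le: "norm (?Q g) \<le> opnorm_on UNIV T * norm g" if g: "g \<in> ?D" for g
  proof (rule norm_blinfun_bound)
    show "0 \<le> opnorm_on UNIV T * norm g" using T0 by simp
    fix x
    have "norm (blinfun_apply g (T x)) \<le> norm g * norm (T x)" by (rule norm_blinfun)
    also have "\<dots> \<le> norm g * (opnorm_on UNIV T * norm x)"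
      by (intro mult_left_mono norm_le_opnorm_on[OF T subspace_UNIV]) simp_all
    finally show "norm (blinfun_apply (?Q g) x) \<le> opnorm_on UNIV T * norm g * norm x"
      unfolding apply_Q[OF g] by (simp add: mult_ac)
  qed
  show Q: "bounded_operator_on dual_smul ?D ?Q"
    unfolding bounded_operator_on_def
  proof (intro conjI ballI allI exI[of _ "opnorm_on UNIV T"])
    show "?Q (g + h) = ?Q g + ?Q h" if "g \<in> ?D" "h \<in> ?D" for g h
      by (rule blinfun_eqI) (simp add: apply_Q that dual.subspace_add[OF D] blinfun.add_left)
    show "?Q (dual_smul c g) = dual_smul c (?Q g)" if "g \<in> ?D" for c g
      by (rule blinfun_eqI) (simp add: apply_Q that dual.subspace_scale[OF D])
  qed (rule Q_le)
  show "opnorm_on ?D ?Q = opnorm_on UNIV T"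
  proof (rule antisym)
    show "opnorm_on ?D ?Q \<le> opnorm_on UNIV T"
      by (intro dual.opnorm_on_le dual.subspace_0[OF D] T0 Q_le)
    show "opnorm_on UNIV T \<le> opnorm_on ?D ?Q"
    proof (rule opnorm_on_le)
      show "0 \<le> opnorm_on ?D ?Q" by (rule dual.opnorm_on_nonneg[OF Q D])
      fix x
      obtain g where g: "g \<in> ?D" "norm g \<le> 1" "norm (T x) \<le> re (blinfun_apply g (T x))"
        by (rule norming_functional_exists)
      note g(3)
      also have "re (blinfun_apply g (T x)) \<le> norm (blinfun_apply (?Q g) x)"
        using abs_re_le[of "blinfun_apply g (T x)"] by (simp add: apply_Q[OF g(1)])
      also have "\<dots> \<le> norm (?Q g) * norm x" by (rule norm_blinfun)
      also have "\<dots> \<le> opnorm_on ?D ?Q * norm x"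
      proof (rule mult_right_mono)
        have "norm (?Q g) \<le> opnorm_on ?D ?Q * norm g" by (rule dual.norm_le_opnorm_on[OF Q D g(1)])
        also have "\<dots> \<le> opnorm_on ?D ?Q * 1"
          by (rule mult_left_mono[OF g(2) dual.opnorm_on_nonneg[OF Q D]])
        finally show "norm (?Q g) \<le> opnorm_on ?D ?Q" by simp
      qed simp
      finally show "norm (T x) \<le> opnorm_on ?D ?Q * norm x" .
    qed simp
  qed
qed

end

section \<open>Functionals with a common kernel\<close>

text \<open>
  Induction on \<open>I\<close>: on the kernel of \<open>p j\<close> the induction hypothesis applies, and the difference
  between \<open>l\<close> and the combination found there vanishes on that kernel, so it is a multiple of \<open>p j\<close>.
  The carrier \<open>S\<close> is needed for functionals defined on the dual space only, which need not exhaust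
  its type.\<close>

lemma (in vector_space) functional_vanishing_on_common_kernel:
  fixes p :: "'i \<Rightarrow> 'b \<Rightarrow> 'a" and l :: "'b \<Rightarrow> 'a"
  assumes "finite I" and "subspace S"
    and "\<And>i x y. i \<in> I \<Longrightarrow> x \<in> S \<Longrightarrow> y \<in> S \<Longrightarrow> p i (x + y) = p i x + p i y"
    and "\<And>i c x. i \<in> I \<Longrightarrow> x \<in> S \<Longrightarrow> p i (scale c x) = c * p i x"
    and "\<And>x y. x \<in> S \<Longrightarrow> y \<in> S \<Longrightarrow> l (x + y) = l x + l y"
    and "\<And>c x. x \<in> S \<Longrightarrow> l (scale c x) = c * l x"
    and "\<And>x. x \<in> S \<Longrightarrow> (\<And>i. i \<in> I \<Longrightarrow> p i x = 0) \<Longrightarrow> l x = 0"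
  shows "\<exists>a. \<forall>x\<in>S. l x = (\<Sum>i\<in>I. a i * p i x)"
  using assms
proof (induction I arbitrary: S rule: finite_induct)
  case empty
  then show ?case by simp
next
  case (insert j I)
  note S = insert.prems(1) and p_add = insert.prems(2) and p_scale = insert.prems(3)
    and l_add = insert.prems(4) and l_scale = insert.prems(5) and l_zero = insert.prems(6)
  define S' where "S' = {x \<in> S. p j x = 0}"
  have p0: "p j 0 = 0" using p_scale[of j 0 0] subspace_0[OF S] by simp
  have S': "subspace S'"
    by (rule subspaceI)
       (auto simp: S'_def p0 p_add p_scale subspace_0[OF S] subspace_add[OF S] subspace_scale[OF S])
  have "\<exists>a. \<forall>x\<in>S'. l x = (\<Sum>i\<in>I. a i * p i x)"
    by (rule insert.IH[OF S']) (auto simp: S'_def p_add p_scale l_add l_scale intro!: l_zero)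
  then obtain a where a: "\<And>x. x \<in> S' \<Longrightarrow> l x = (\<Sum>i\<in>I. a i * p i x)" by blast
  define m where "m x = l x - (\<Sum>i\<in>I. a i * p i x)" for x
  have m_add: "m (x + y) = m x + m y" if "x \<in> S" "y \<in> S" for x y
    using that by (simp add: m_def l_add p_add distrib_left sum.distrib)
  have m_scale: "m (scale c x) = c * m x" if "x \<in> S" for c x
    using that by (simp add: m_def l_scale p_scale right_diff_distrib sum_distrib_left mult.left_commute)
  have m_S': "m x = 0" if "x \<in> S'" for x using a[OF that] by (simp add: m_def)
  have "\<exists>a'. \<forall>x\<in>S. m x = a' * p j x"
  proof (cases "\<exists>x0\<in>S. p j x0 \<noteq> 0")
    case True
    then obtain x0 where x0: "x0 \<in> S" "p j x0 \<noteq> 0" by blast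
    have "m x = (m x0 / p j x0) * p j x" if x: "x \<in> S" for x
    proof -
      define y where "y = x + scale (- (p j x / p j x0)) x0"
      have s: "scale (- (p j x / p j x0)) x0 \<in> S" by (rule subspace_scale[OF S x0(1)])
      have "p j y = p j x - p j x / p j x0 * p j x0"
        unfolding y_def using p_add[OF insertI1 x s] p_scale[OF insertI1 x0(1)] by (simp del: scale_minus_left)
      then have y: "y \<in> S'" using x0(2) subspace_add[OF S x s] by (simp add: y_def S'_def)
      have "m y = m x - (p j x / p j x0) * m x0"
        unfolding y_def using m_add[OF x subspace_scale[OF S x0(1)]] m_scale[OF x0(1)] by (simp del: scale_minus_left)
      then show ?thesis using m_S'[OF y] by simp
    qed
    then show ?thesis by blast
  next
    case False
    then show ?thesis using m_S' by (intro exI[of _ 0]) (auto simp: S'_def)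
  qed
  then obtain a' where a': "\<And>x. x \<in> S \<Longrightarrow> m x = a' * p j x" by blast
  have "l x = (\<Sum>i\<in>insert j I. (a(j := a')) i * p i x)" if "x \<in> S" for x
  proof -
    have "(\<Sum>i\<in>I. (a(j := a')) i * p i x) = (\<Sum>i\<in>I. a i * p i x)"
      using insert.hyps by (intro sum.cong) auto
    then show ?thesis using a'[OF that] insert.hyps by (simp add: m_def diff_eq_eq)
  qed
  then show ?case by blast
qed

context normed_space_over begin

text \<open>
  If no vector were killed by all \<open>f i\<close> with \<open>i \<noteq> j\<close> but not by \<open>f j\<close>, then \<open>f j\<close> would vanish on the
  common kernel of the others and be a combination of them.\<close>

lemma biorthogonal_vectors_exist:
  assumes J: "finite J" and f: "\<And>j. j \<in> J \<Longrightarrow> f j \<in> dual_space smul"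
    and inj: "inj_on f J" and indep: "dual.independent (f ` J)"
  obtains b where "\<And>i j. i \<in> J \<Longrightarrow> j \<in> J \<Longrightarrow> blinfun_apply (f i) (b j) = (if i = j then 1 else 0)"
proof -
  have "\<exists>x. \<forall>i\<in>J. blinfun_apply (f i) x = (if i = j then 1 else 0)" if j: "j \<in> J" for j
  proof (rule ccontr)
    assume no: "\<nexists>x. \<forall>i\<in>J. blinfun_apply (f i) x = (if i = j then 1 else 0)"
    have zero: "blinfun_apply (f j) x = 0" if x: "\<And>i. i \<in> J - {j} \<Longrightarrow> blinfun_apply (f i) x = 0" for x
    proof (rule ccontr)
      assume nz: "blinfun_apply (f j) x \<noteq> 0"
      have "\<forall>i\<in>J. blinfun_apply (f i) (smul (inverse (blinfun_apply (f j) x)) x) = (if i = j then 1 else 0)"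
        using nz x by (auto simp: dual_apply_smul[OF f])
      with no show False by blast
    qed
    have "\<exists>a. \<forall>x\<in>UNIV. blinfun_apply (f j) x = (\<Sum>i\<in>J - {j}. a i * blinfun_apply (f i) x)"
      by (rule functional_vanishing_on_common_kernel)
         (use J j f zero in \<open>auto simp: blinfun.add_right dual_apply_smul\<close>)
    then obtain a where "\<And>x. blinfun_apply (f j) x = (\<Sum>i\<in>J - {j}. a i * blinfun_apply (f i) x)"
      by blast
    then have "f j = (\<Sum>i\<in>J - {j}. dual_smul (a i) (f i))"
      by (intro blinfun_eqI) (simp add: blinfun.sum_left)
    also have "\<dots> \<in> dual.span (f ` (J - {j}))"
      by (intro dual.span_sum dual.span_scale dual.span_base) auto
    also have "f ` (J - {j}) = f ` J - {f j}"
      using inj j by (auto simp: inj_on_def)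
    finally show False using indep j by (auto simp: dual.dependent_def)
  qed
  then obtain b where "\<And>j. j \<in> J \<Longrightarrow> \<forall>i\<in>J. blinfun_apply (f i) (b j) = (if i = j then 1 else 0)"
    by metis
  then show ?thesis using that by blast
qed

end

section \<open>Finite-rank operators on Daugavet spaces\<close>

text \<open>
  A quadratic form equivalent to the square of the modulus and its polarisation. Over \<open>\<real>\<close>, where
  the imaginary unit is 0, and over \<open>\<complex>\<close> it is the square of the modulus itself; a bound up to a
  constant is all that strict convexity arguments need.\<close>

definition scalar_square :: "'k::real_or_complex \<Rightarrow> real" where
  "scalar_square a = (re a)\<^sup>2 + (re (imag_unit * a))\<^sup>2"

definition scalar_pairing :: "'k::real_or_complex \<Rightarrow> 'k \<Rightarrow> real" where
  "scalar_pairing a b = re a * re b + re (imag_unit * a) * re (imag_unit * b)"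

lemma norm_le_re_parts:
  fixes a :: "'a::real_or_complex"
  shows "norm a \<le> \<bar>re a\<bar> + \<bar>re (imag_unit * a)\<bar>"
proof -
  let ?s = "re a" and ?t = "re (imag_unit * a)"
  have "norm (of_real ?s - imag_unit * of_real ?t :: 'a)
      \<le> norm (of_real ?s :: 'a) + norm (imag_unit * of_real ?t :: 'a)"
    by (rule norm_triangle_ineq4)
  also have "norm (imag_unit * of_real ?t :: 'a) \<le> \<bar>?t\<bar>"
    using mult_right_mono[OF norm_imag_unit_le[where ?'k = 'a], of "\<bar>?t\<bar>"] by (simp add: norm_mult)
  finally show ?thesis
    using scalar_decomposition[of a] by simp
qed

lemma norm_square_le: "(norm a)\<^sup>2 \<le> 2 * scalar_square a"
proof -
  let ?s = "re a" and ?t = "re (imag_unit * a)"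
  have "norm a \<le> \<bar>?s\<bar> + \<bar>?t\<bar>" by (rule norm_le_re_parts)
  then have "(norm a)\<^sup>2 \<le> (\<bar>?s\<bar> + \<bar>?t\<bar>)\<^sup>2" by (rule power_mono) simp
  also have "\<dots> \<le> 2 * (\<bar>?s\<bar>\<^sup>2 + \<bar>?t\<bar>\<^sup>2)" using arith_geo_mean[of "\<bar>?s\<bar>\<^sup>2" "\<bar>?t\<bar>" "\<bar>?s\<bar>"]
    using sum_squares_bound[of "\<bar>?s\<bar>" "\<bar>?t\<bar>"] by (simp add: power2_sum)
  finally show ?thesis by (simp add: scalar_square_def)
qed

lemma scalar_square_le: "scalar_square a \<le> 2 * (norm a)\<^sup>2"
proof -
  have "norm (imag_unit * a) \<le> norm a"
    using mult_right_mono[OF norm_imag_unit_le[where ?'k = 'a], of "norm a"] by (simp add: norm_mult)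
  then have "\<bar>re (imag_unit * a)\<bar> \<le> \<bar>norm a\<bar>" "\<bar>re a\<bar> \<le> \<bar>norm a\<bar>"
    using abs_re_le[of "imag_unit * a"] abs_re_le[of a] by auto
  then show ?thesis unfolding scalar_square_def abs_le_square_iff by simp
qed

text \<open>
  This identity quantifies strict convexity: the form exceeds its tangent at \<open>b\<close> by its own value at
  the displacement.\<close>

lemma scalar_square_diff:
  "scalar_square a = scalar_square b + 2 * scalar_pairing b (a - b) + scalar_square (a - b)"
  by (simp add: scalar_square_def scalar_pairing_def right_diff_distrib re_minus power2_eq_square algebra_simps)

lemma linear_scalar_pairing: "linear (scalar_pairing a)"
proof (intro linearI)
  fix b c :: 'a and r
  show "scalar_pairing a (b + c) = scalar_pairing a b + scalar_pairing a c"
    by (simp add: scalar_pairing_def re_add distrib_left)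
  have "imag_unit * (r *\<^sub>R b) = of_real r * (imag_unit * b)" by (simp add: scaleR_conv_of_real)
  then show "scalar_pairing a (r *\<^sub>R b) = r *\<^sub>R scalar_pairing a b"
    using re_of_real_mult[of r "imag_unit * b"] re_of_real_mult[of r b]
    by (simp add: scalar_pairing_def scaleR_conv_of_real distrib_left mult.left_commute)
qed

lemma scalar_pairing_self: "scalar_pairing a a = scalar_square a"
  by (simp add: scalar_pairing_def scalar_square_def power2_eq_square)

context normed_space_over begin

text \<open>
  The operator \<open>T x = (\<phi> x / \<parallel>\<phi>\<parallel>) z\<close> has rank one and norm \<open>\<parallel>z\<parallel>\<close>. A point where \<open>Id + T\<close> almost attains
  the norm \<open>1 + \<parallel>z\<parallel>\<close> must make \<open>\<bar>\<phi> x\<bar>\<close> almost maximal; after a rotation \<open>\<phi> x\<close> is positive and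
  \<open>T x\<close> is close to \<open>z\<close>.\<close>

lemma daugavet_slice:
  assumes daugavet: "daugavet_property smul" and \<phi>: "\<phi> \<in> dual_space smul" "\<phi> \<noteq> 0"
    and z: "z \<noteq> 0" and "0 < \<epsilon>"
  obtains x where "norm x \<le> 1" "norm \<phi> - \<epsilon> < re (blinfun_apply \<phi> x)"
    "1 + norm z - \<epsilon> < norm (x + z)"
proof -
  define t where "t x = norm (blinfun_apply \<phi> x) / norm \<phi>" for x
  have \<phi>_pos: "0 < norm \<phi>" using \<phi>(2) by simp
  have z_pos: "0 < norm z" using z by simp
  define h where "h x = smul (blinfun_apply \<phi> x / of_real (norm \<phi>)) z" for x
  have h_add: "h (x + y) = h x + h y" for x y
    by (simp add: h_def blinfun.add_right add_divide_distrib scale_left_distrib)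
  have h_smul: "h (smul c x) = smul c (h x)" for c x
    by (simp add: h_def dual_apply_smul[OF \<phi>(1)])
  have norm_h: "norm (h x) = t x * norm z" for x
    by (simp add: h_def t_def norm_smul norm_divide)
  have t_le: "t x \<le> norm x" for x
    using norm_blinfun[of \<phi> x] \<phi>_pos by (simp add: t_def field_simps)
  have blin: "bounded_linear h"
  proof (rule bounded_linear_intro)
    show "h (r *\<^sub>R x) = r *\<^sub>R h x" for r x using h_smul[of "of_real r" x] by (simp add: smul_of_real)
    show "norm (h x) \<le> norm x * norm z" for x
      unfolding norm_h by (intro mult_right_mono t_le) simp
  qed (rule h_add)
  define T where "T = Blinfun h"
  have T: "blinfun_apply T = h" by (simp add: T_def bounded_linear_Blinfun_apply[OF blin])
  have "range h = span {z}"
  proof -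
    obtain x0 where x0: "blinfun_apply \<phi> x0 \<noteq> 0"
      using \<phi>(2) blinfun_eqI[of \<phi> 0] by auto
    have "smul c z = h (smul (c * of_real (norm \<phi>) / blinfun_apply \<phi> x0) x0)" for c
      using x0 \<phi>_pos by (simp add: h_def dual_apply_smul[OF \<phi>(1)])
    then have "smul c z \<in> range h" for c by (metis rangeI)
    moreover have "h x \<in> range (\<lambda>c. smul c z)" for x
      unfolding h_def by (rule rangeI)
    ultimately show ?thesis by (auto simp: span_singleton)
  qed
  then have dim: "dim (range h) = 1"
    using dim_span_eq_card_independent[of "{z}"] z by (simp add: dependent_single)
  have "Vector_Spaces.linear smul smul h"
    using vector_space_axioms h_add h_smul by (simp add: Vector_Spaces.linear_iff)
  with daugavet dim have norm_id_T: "norm (id_blinfun + T) = 1 + norm T"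
    by (simp add: daugavet_property_def T)
  have norm_T: "norm z \<le> norm T"
  proof -
    have "norm \<phi> \<le> norm T / norm z * norm \<phi>"
    proof (rule norm_blinfun_bound)
      fix x
      have "t x * norm z \<le> norm T * norm x" using norm_blinfun[of T x] by (simp add: T norm_h)
      then show "norm (blinfun_apply \<phi> x) \<le> norm T / norm z * norm \<phi> * norm x"
        using \<phi>_pos z_pos by (simp add: t_def field_simps)
    qed simp
    then show ?thesis using \<phi>_pos z_pos by (simp add: field_simps)
  qed
  define \<delta> where "\<delta> = min (\<epsilon> / 2) (\<epsilon> * norm z / norm \<phi>)"
  have \<delta>: "0 < \<delta>" "\<delta> \<le> \<epsilon> / 2" "\<delta> * norm \<phi> \<le> \<epsilon> * norm z"
    using \<open>0 < \<epsilon>\<close> \<phi>_pos z_pos by (auto simp: \<delta>_def min_def field_simps)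
  obtain x where x: "norm x \<le> 1" "1 + norm z - \<delta> < norm (x + h x)"
  proof (rule ccontr)
    assume "\<not> thesis"
    then have "norm (blinfun_apply (id_blinfun + T) x) \<le> 1 + norm z - \<delta>" if "norm x \<le> 1" for x
      using that \<open>\<And>x. norm x \<le> 1 \<Longrightarrow> 1 + norm z - \<delta> < norm (x + h x) \<Longrightarrow> thesis\<close>
      by (fastforce simp: T blinfun.add_left)
    then have "norm (id_blinfun + T) \<le> 1 + norm z - \<delta>" by (rule norm_blinfun_le_on_unit_ball)
    with norm_id_T norm_T \<delta>(1) show False by simp
  qed
  obtain \<theta> where \<theta>: "norm \<theta> = 1" "\<theta> * blinfun_apply \<phi> x = of_real (norm (blinfun_apply \<phi> x))"
    by (rule unimodular_rotation)
  define y where "y = smul \<theta> x"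
  have \<phi>_y: "blinfun_apply \<phi> y = of_real (norm (blinfun_apply \<phi> x))"
    by (simp add: y_def dual_apply_smul[OF \<phi>(1)] \<theta>(2))
  have h_y: "h y = t x *\<^sub>R z"
    by (simp add: h_def \<phi>_y t_def flip: smul_of_real)
  have norm_y: "norm (y + h y) = norm (x + h x)"
    by (simp add: y_def h_smul norm_smul \<theta>(1) flip: scale_right_distrib)
  have "norm (x + h x) \<le> norm x + t x * norm z"
    using norm_triangle_ineq[of x "h x"] by (simp add: norm_h)
  with x have t_gt: "norm z - \<delta> < t x * norm z" by simp
  have t1: "t x \<le> 1" using t_le[of x] x(1) by simp
  show ?thesis
  proof (rule that[of y])
    show "norm y \<le> 1" by (simp add: y_def norm_smul \<theta>(1) x(1))
    have "(norm z - \<delta>) * norm \<phi> < t x * norm z * norm \<phi>"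
      using t_gt \<phi>_pos by (rule mult_strict_right_mono)
    also have "\<dots> = norm z * norm (blinfun_apply \<phi> x)" using \<phi>_pos by (simp add: t_def)
    finally have "norm z * (norm \<phi> - \<epsilon>) < norm z * norm (blinfun_apply \<phi> x)"
      using \<delta>(3) by (simp add: algebra_simps)
    then show "norm \<phi> - \<epsilon> < re (blinfun_apply \<phi> y)"
      using z_pos by (simp add: \<phi>_y re_of_real)
    have "norm (y + h y) \<le> norm (y + z) + norm (h y - z)"
      using norm_triangle_ineq[of "y + z" "h y - z"] by (simp add: algebra_simps)
    also have "norm (h y - z) = (1 - t x) * norm z"
    proof -
      have "h y - z = - ((1 - t x) *\<^sub>R z)" by (simp add: h_y algebra_simps)
      then show ?thesis using t1 by simp
    qed
    finally show "1 + norm z - \<epsilon> < norm (y + z)"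
      using x(2) t_gt \<delta>(2) by (simp add: norm_y algebra_simps)
  qed
qed

text \<open>
  The norm of \<open>T x\<close> alone may be almost maximal at points whose images are far apart. Adding a
  small multiple \<open>\<eta> q\<close> of a strictly convex quadratic form \<open>q\<close> in the coordinates \<open>f j x\<close> repairs
  this: let \<open>x0\<close> almost maximise \<open>G x = \<parallel>T x\<parallel> + \<eta> q x\<close> on the ball, let \<open>\<psi>\<close> be the derivative of
  \<open>\<eta> q\<close> at \<open>x0\<close> plus a norming functional at \<open>T x0\<close>. By convexity \<open>\<psi> x + \<eta> q (x - x0)\<close> exceeds
  \<open>\<psi> x0\<close> by no more than \<open>G x\<close> exceeds \<open>G x0\<close>, so where \<open>\<psi>\<close> is almost maximal, \<open>q (x - x0)\<close>
  is small, and \<open>q\<close> controls \<open>T\<close>.\<close>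

lemma strongly_exposing_functional:
  fixes T :: "'a \<Rightarrow>\<^sub>L 'a"
  assumes J: "finite J" and f: "\<And>j. j \<in> J \<Longrightarrow> f j \<in> dual_space smul"
    and T: "\<And>x. blinfun_apply T x = (\<Sum>j\<in>J. smul (blinfun_apply (f j) x) (u j))"
    and \<epsilon>: "0 < \<epsilon>" "\<epsilon> < norm T"
  obtains x0 g \<delta> where "norm x0 \<le> 1" "norm T - \<epsilon> \<le> norm (blinfun_apply T x0)"
    "g \<in> dual_space smul" "g \<noteq> 0" "0 < \<delta>"
    "\<forall>x. norm x \<le> 1 \<and> norm g - \<delta> < re (blinfun_apply g x) \<longrightarrow>
      norm (blinfun_apply T x - blinfun_apply T x0) \<le> \<epsilon>"
proof -
  define q where "q x = (\<Sum>j\<in>J. scalar_square (blinfun_apply (f j) x))" for x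
  define R where "R = (\<Sum>j\<in>J. 2 * (norm (f j))\<^sup>2)"
  define C where "C = 2 * (\<Sum>j\<in>J. (norm (u j))\<^sup>2)"
  have R0: "0 \<le> R" and C0: "0 \<le> C" by (auto simp: R_def C_def intro!: sum_nonneg mult_nonneg_nonneg)
  have q0: "0 \<le> q x" for x by (auto simp: q_def scalar_square_def intro!: sum_nonneg)
  have q_le: "q x \<le> R" if "norm x \<le> 1" for x
    unfolding q_def R_def
  proof (rule sum_mono)
    fix j
    have "norm (blinfun_apply (f j) x) \<le> norm (f j)"
      using norm_blinfun[of "f j" x] mult_left_mono[OF that, of "norm (f j)"] by simp
    then have "(norm (blinfun_apply (f j) x))\<^sup>2 \<le> (norm (f j))\<^sup>2" by (simp add: power_mono)
    then show "scalar_square (blinfun_apply (f j) x) \<le> 2 * (norm (f j))\<^sup>2"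
      using scalar_square_le[of "blinfun_apply (f j) x"] by linarith
  qed
  have T_le: "(norm (blinfun_apply T x))\<^sup>2 \<le> C * q x" for x
  proof -
    have "norm (blinfun_apply T x) \<le> (\<Sum>j\<in>J. norm (blinfun_apply (f j) x) * norm (u j))"
      unfolding T by (rule order_trans[OF norm_sum]) (simp add: norm_smul)
    then have "(norm (blinfun_apply T x))\<^sup>2 \<le> (\<Sum>j\<in>J. norm (blinfun_apply (f j) x) * norm (u j))\<^sup>2"
      by (rule power_mono) simp
    also have "\<dots> \<le> (\<Sum>j\<in>J. (norm (blinfun_apply (f j) x))\<^sup>2) * (\<Sum>j\<in>J. (norm (u j))\<^sup>2)"
      by (rule Cauchy_Schwarz_ineq_sum)
    also have "\<dots> \<le> (2 * q x) * (\<Sum>j\<in>J. (norm (u j))\<^sup>2)"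
      unfolding q_def sum_distrib_left
      by (intro mult_right_mono sum_mono norm_square_le sum_nonneg) auto
    finally show ?thesis by (simp add: C_def algebra_simps)
  qed
  \<comment> \<open>The weight \<open>\<eta>\<close> makes the quadratic term at most \<open>\<epsilon> / 2\<close> on the ball; the tolerance \<open>\<delta>\<close> makes
    \<open>C q (x - x0) \<le> 2 C \<delta> / \<eta> \<le> \<epsilon>\<^sup>2\<close> in the slice.\<close>
  define \<eta> where "\<eta> = \<epsilon> / (2 * (R + 1))"
  define \<delta> where "\<delta> = min (\<epsilon> / 2) (\<eta> * \<epsilon>\<^sup>2 / (2 * (C + 1)))"
  have \<eta>: "0 < \<eta>" "\<eta> * R \<le> \<epsilon> / 2" using \<epsilon> R0 by (auto simp: \<eta>_def field_simps)
  have \<delta>: "0 < \<delta>" "\<delta> \<le> \<epsilon> / 2" and \<delta>': "C * (2 * \<delta>) \<le> \<eta> * \<epsilon>\<^sup>2"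
  proof -
    have p: "0 < \<eta> * \<epsilon>\<^sup>2 / (2 * (C + 1))" using \<eta> \<epsilon> C0 by simp
    show "0 < \<delta>" "\<delta> \<le> \<epsilon> / 2" using p \<epsilon> by (simp_all only: \<delta>_def min_less_iff_conj min.cobounded1) simp
    have "\<delta> \<le> \<eta> * \<epsilon>\<^sup>2 / (2 * (C + 1))" by (simp only: \<delta>_def min.cobounded2)
    then have "\<delta> * (2 * (C + 1)) \<le> \<eta> * \<epsilon>\<^sup>2" using C0 by (subst (asm) pos_le_divide_eq) auto
    then show "C * (2 * \<delta>) \<le> \<eta> * \<epsilon>\<^sup>2" using \<open>0 < \<delta>\<close> by (simp add: algebra_simps)
  qed
  define G where "G x = norm (blinfun_apply T x) + \<eta> * q x" for x
  obtain x0 where x0: "norm x0 \<le> 1" and max: "\<And>x. norm x \<le> 1 \<Longrightarrow> G x \<le> G x0 + \<delta>"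
  proof -
    have bdd: "bdd_above (G ` cball 0 1)"
    proof (rule bdd_aboveI2)
      fix x :: 'a assume "x \<in> cball 0 1"
      then have x: "norm x \<le> 1" by simp
      have "norm (blinfun_apply T x) \<le> norm T"
        using norm_blinfun[of T x] mult_left_mono[OF x, of "norm T"] by simp
      moreover have "\<eta> * q x \<le> \<eta> * R" using q_le[OF x] \<eta>(1) by simp
      ultimately show "G x \<le> norm T + \<eta> * R" by (simp add: G_def)
    qed
    have "(SUP x\<in>cball 0 1. G x) - \<delta> < (SUP x\<in>cball 0 1. G x)" using \<delta> by simp
    moreover have "cball (0::'a) 1 \<noteq> {}" by simp
    ultimately obtain x0 where "x0 \<in> cball 0 1" "(SUP x\<in>cball 0 1. G x) - \<delta> < G x0"
      using less_cSUP_iff[OF _ bdd] by blast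
    moreover have "G x \<le> (SUP x\<in>cball 0 1. G x)" if "norm x \<le> 1" for x
      using cSUP_upper[OF _ bdd] that by simp
    ultimately show ?thesis using that by fastforce
  qed
  have norm_T: "norm T \<le> norm (blinfun_apply T x0) + \<epsilon>"
  proof (rule norm_blinfun_le_on_unit_ball)
    fix x :: 'a assume x: "norm x \<le> 1"
    have "norm (blinfun_apply T x) \<le> G x" using q0[of x] \<eta> by (simp add: G_def)
    also have "\<dots> \<le> norm (blinfun_apply T x0) + \<eta> * q x0 + \<delta>" using max[OF x] by (simp add: G_def)
    also have "\<eta> * q x0 \<le> \<eta> * R" using q_le[OF x0] \<eta>(1) by simp
    finally show "norm (blinfun_apply T x) \<le> norm (blinfun_apply T x0) + \<epsilon>"
      using \<eta>(2) \<delta>(2) by linarith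
  qed
  obtain h where h: "h \<in> dual_space smul" "norm h \<le> 1"
    "norm (blinfun_apply T x0) \<le> re (blinfun_apply h (blinfun_apply T x0))"
    by (rule norming_functional_exists)
  have re_h: "re (blinfun_apply h y) \<le> norm y" for y
    using abs_re_le[of "blinfun_apply h y"] norm_blinfun[of h y] mult_right_mono[OF h(2), of "norm y"]
    by simp
  define pair where
    "pair x = (\<Sum>j\<in>J. scalar_pairing (blinfun_apply (f j) x0) (blinfun_apply (f j) x))" for x
  define \<psi> where "\<psi> x = re (blinfun_apply h (blinfun_apply T x)) + 2 * \<eta> * pair x" for x
  have linear_re: "linear (re :: 'k \<Rightarrow> real)"
    by (intro linearI) (simp_all add: re_add re_of_real_mult scaleR_conv_of_real)
  have linear_pair: "linear pair"
    unfolding pair_def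
    by (intro linear_compose_sum ballI linear_compose[OF _ linear_scalar_pairing, unfolded o_def]
        bounded_linear.linear[OF blinfun.bounded_linear_right])
  have linear_\<psi>: "linear \<psi>"
  proof -
    have "linear (\<lambda>x. re (blinfun_apply h (blinfun_apply T x)))"
      by (intro linear_compose[OF _ linear_re, unfolded o_def] bounded_linear.linear
          bounded_linear_compose[OF blinfun.bounded_linear_right] blinfun.bounded_linear_right)
    moreover have "linear (\<lambda>x. 2 * \<eta> * pair x)"
      using linear_compose_scale_right[OF linear_pair, of "2 * \<eta>"] by simp
    ultimately show ?thesis unfolding \<psi>_def by (rule linear_compose_add)
  qed
  have q_expand: "q x = q x0 + 2 * (pair x - pair x0) + q (x - x0)" for x
  proof -
    have "q x = (\<Sum>j\<in>J. scalar_square (blinfun_apply (f j) x0)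
        + 2 * scalar_pairing (blinfun_apply (f j) x0) (blinfun_apply (f j) (x - x0))
        + scalar_square (blinfun_apply (f j) (x - x0)))"
      unfolding q_def blinfun.diff_right by (intro sum.cong refl scalar_square_diff)
    also have "\<dots> = q x0 + 2 * pair (x - x0) + q (x - x0)"
      by (simp add: q_def pair_def sum.distrib sum_distrib_left)
    finally show ?thesis using linear_diff[OF linear_pair] by simp
  qed
  have \<psi>_x0: "norm (blinfun_apply T x0) \<le> \<psi> x0"
  proof -
    have "pair x0 = q x0" by (simp add: pair_def scalar_pairing_self q_def)
    then have "0 \<le> 2 * \<eta> * pair x0" using q0[of x0] \<eta>(1) by simp
    then show ?thesis using h(3) unfolding \<psi>_def by linarith
  qed
  have \<psi>_le: "\<psi> x + \<eta> * q (x - x0) \<le> \<psi> x0 + \<delta>" if "norm x \<le> 1" for x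
  proof -
    have "re (blinfun_apply h (blinfun_apply T x)) + \<eta> * q x \<le> G x"
      using re_h by (simp add: G_def)
    also have "\<dots> \<le> G x0 + \<delta>" by (rule max[OF that])
    also have "G x0 \<le> re (blinfun_apply h (blinfun_apply T x0)) + \<eta> * q x0"
      using h(3) by (simp add: G_def)
    finally show ?thesis
      by (simp add: \<psi>_def q_expand[of x] algebra_simps)
  qed
  define M where "M = \<psi> x0 + \<delta>"
  have \<psi>_M: "\<psi> x \<le> M" if "norm x \<le> 1" for x
    using \<psi>_le[OF that] mult_nonneg_nonneg[OF less_imp_le[OF \<eta>(1)] q0[of "x - x0"]]
    by (simp add: M_def)
  have M0: "0 \<le> M" using \<psi>_M[of 0] linear_0[OF linear_\<psi>] by simp
  have "\<psi> x \<le> M * norm x" for x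
  proof (cases "x = 0")
    case False
    then show ?thesis using \<psi>_M[of "x /\<^sub>R norm x"]
      by (simp add: linear_cmul[OF linear_\<psi>] field_simps)
  qed (simp add: linear_0[OF linear_\<psi>])
  then obtain g where g: "g \<in> dual_space smul" "\<And>x. re (blinfun_apply g x) = \<psi> x" "norm g \<le> M"
    using dual_functional_of_real_part[OF linear_\<psi> _ M0] by blast
  have \<psi>_g: "\<psi> x0 \<le> norm g"
    using g(2)[of x0] abs_re_le[of "blinfun_apply g x0"] norm_blinfun[of g x0]
      mult_left_mono[OF x0, of "norm g"] by simp
  show ?thesis
  proof (rule that[OF x0 _ g(1) _ \<delta>(1)]; (intro allI impI, elim conjE)?)
    show "norm T - \<epsilon> \<le> norm (blinfun_apply T x0)" using norm_T by simp
    show "g \<noteq> 0" using \<psi>_g \<psi>_x0 norm_T \<epsilon> by auto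
    fix x :: 'a assume x: "norm x \<le> 1" and slice: "norm g - \<delta> < re (blinfun_apply g x)"
    have "\<eta> * q (x - x0) \<le> 2 * \<delta>" using \<psi>_le[OF x] slice \<psi>_g by (simp add: g(2))
    then have "C * (\<eta> * q (x - x0)) \<le> \<eta> * \<epsilon>\<^sup>2"
      using \<delta>' mult_left_mono[OF _ C0] by (meson order_trans)
    then have "\<eta> * (C * q (x - x0)) \<le> \<eta> * \<epsilon>\<^sup>2" by (simp add: mult.left_commute)
    then have "C * q (x - x0) \<le> \<epsilon>\<^sup>2" using \<eta>(1) by simp
    with T_le[of "x - x0"] have "(norm (blinfun_apply T (x - x0)))\<^sup>2 \<le> \<epsilon>\<^sup>2" by linarith
    then have "norm (blinfun_apply T (x - x0)) \<le> \<epsilon>" using \<epsilon>(1) by (simp add: power2_le_iff_abs_le)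
    then show "norm (blinfun_apply T x - blinfun_apply T x0) \<le> \<epsilon>" by (simp add: blinfun.diff_right)
  qed
qed

text \<open>
  In the slice on which \<open>T x\<close> is close to \<open>T x0\<close> there is a point with \<open>\<parallel>x + T x0\<parallel>\<close> close to
  \<open>1 + \<parallel>T x0\<parallel>\<close>, and there \<open>x + T x0\<close> may be replaced by \<open>x + T x\<close>.\<close>

theorem daugavet_finite_rank:
  fixes T :: "'a \<Rightarrow>\<^sub>L 'a"
  assumes daugavet: "daugavet_property smul"
    and J: "finite J" and f: "\<And>j. j \<in> J \<Longrightarrow> f j \<in> dual_space smul"
    and T: "\<And>x. blinfun_apply T x = (\<Sum>j\<in>J. smul (blinfun_apply (f j) x) (u j))"
    and "T \<noteq> 0"
  shows "norm (id_blinfun + T) = 1 + norm T"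
proof (rule antisym)
  show "norm (id_blinfun + T) \<le> 1 + norm T"
    using norm_triangle_ineq[of id_blinfun T] norm_blinfun_id_le[where ?'a = 'a] by linarith
  have pos: "0 < norm T" using \<open>T \<noteq> 0\<close> by simp
  have approx: "1 + norm T \<le> norm (id_blinfun + T) + 3 * \<epsilon>" if \<epsilon>: "0 < \<epsilon>" "\<epsilon> < norm T" for \<epsilon>
  proof -
    obtain x0 g \<delta> where "norm x0 \<le> 1" and x0: "norm T - \<epsilon> \<le> norm (blinfun_apply T x0)"
      and g: "g \<in> dual_space smul" "g \<noteq> 0" and "0 < \<delta>"
      and slice: "\<forall>x. norm x \<le> 1 \<and> norm g - \<delta> < re (blinfun_apply g x) \<longrightarrow>
        norm (blinfun_apply T x - blinfun_apply T x0) \<le> \<epsilon>"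
      by (rule strongly_exposing_functional[OF J f T \<epsilon>])
    have nz: "blinfun_apply T x0 \<noteq> 0" using x0 \<epsilon> by auto
    have "0 < min \<delta> \<epsilon>" using \<open>0 < \<delta>\<close> \<epsilon> by simp
    then obtain x where x: "norm x \<le> 1" "norm g - min \<delta> \<epsilon> < re (blinfun_apply g x)"
      "1 + norm (blinfun_apply T x0) - min \<delta> \<epsilon> < norm (x + blinfun_apply T x0)"
      using daugavet_slice[OF daugavet g nz] by blast
    have "norm (x + blinfun_apply T x0)
        \<le> norm (x + blinfun_apply T x) + norm (blinfun_apply T x - blinfun_apply T x0)"
      using norm_triangle_ineq4[of "x + blinfun_apply T x" "blinfun_apply T x - blinfun_apply T x0"]
      by simp
    moreover have "norm (blinfun_apply T x - blinfun_apply T x0) \<le> \<epsilon>"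
      using x slice by auto
    moreover have "norm (x + blinfun_apply T x) \<le> norm (id_blinfun + T)"
      using norm_blinfun[of "id_blinfun + T" x] mult_left_mono[OF x(1), of "norm (id_blinfun + T)"]
      by (simp add: blinfun.add_left)
    ultimately show ?thesis using x(3) x0 min.cobounded2[of \<delta> \<epsilon>] by linarith
  qed
  show "1 + norm T \<le> norm (id_blinfun + T)"
  proof (rule ccontr)
    assume gap: "\<not> 1 + norm T \<le> norm (id_blinfun + T)"
    define \<epsilon> where "\<epsilon> = min (norm T / 2) ((1 + norm T - norm (id_blinfun + T)) / 6)"
    have "0 < \<epsilon>" "\<epsilon> < norm T" "6 * \<epsilon> \<le> 1 + norm T - norm (id_blinfun + T)"
      using gap pos by (auto simp: \<epsilon>_def min_def)
    with approx[of \<epsilon>] show False by linarith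
  qed
qed

end

section \<open>Projections along a subspace of finite codimension\<close>

text \<open>
  In coordinates adapted to the functionals, membership in \<open>W\<close> and operators that vanish on \<open>Y\<close>
  have explicit expansions.\<close>

locale biorthogonal_system = normed_space_over smul
  for smul :: "'k::real_or_complex \<Rightarrow> 'a::real_normed_vector \<Rightarrow> 'a" +
  fixes J :: "'i set" and f :: "'i \<Rightarrow> 'a \<Rightarrow>\<^sub>L 'k" and b :: "'i \<Rightarrow> 'a"
  assumes finite_J: "finite J"
    and f_dual: "j \<in> J \<Longrightarrow> f j \<in> dual_space smul"
    and biorthogonal: "i \<in> J \<Longrightarrow> j \<in> J \<Longrightarrow> blinfun_apply (f i) (b j) = (if i = j then 1 else 0)"
begin

definition Y :: "'a set" where "Y = (\<Inter>j\<in>J. {x. blinfun_apply (f j) x = 0})"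

definition W :: "('a \<Rightarrow>\<^sub>L 'k) set" where "W = dual.span (f ` J)"

text \<open>
  A projection of finite rank along \<open>Y\<close>. Operators and functionals that vanish on \<open>Y\<close> do not
  distinguish \<open>x\<close> from \<open>base x\<close>.\<close>

definition base :: "'a \<Rightarrow> 'a" where "base x = (\<Sum>j\<in>J. smul (blinfun_apply (f j) x) (b j))"

abbreviation "D \<equiv> dual_space smul"

lemmas subspace_D = subspace_dual_space[OF normed_space_over_axioms]

lemma apply_sum_f:
  assumes "i \<in> J"
  shows "(\<Sum>j\<in>J. a j * blinfun_apply (f i) (b j)) = a i"
proof -
  have "(\<Sum>j\<in>J. a j * blinfun_apply (f i) (b j)) = (\<Sum>j\<in>J. if i = j then a j else 0)"
    by (rule sum.cong) (use assms in \<open>auto simp: biorthogonal\<close>)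
  then show ?thesis using finite_J assms by simp
qed

lemma mem_Y_iff: "y \<in> Y \<longleftrightarrow> (\<forall>j\<in>J. blinfun_apply (f j) y = 0)"
  by (simp add: Y_def)

lemma subspace_Y: "subspace Y"
  by (rule subspaceI) (simp_all add: mem_Y_iff blinfun.add_right dual_apply_smul f_dual)

lemma f_base: "j \<in> J \<Longrightarrow> blinfun_apply (f j) (base x) = blinfun_apply (f j) x"
  by (simp add: base_def blinfun.sum_right dual_apply_smul f_dual apply_sum_f)

lemma diff_base_in_Y: "x - base x \<in> Y"
  by (simp add: mem_Y_iff blinfun.diff_right f_base)

lemma base_vanishes_on_Y: "y \<in> Y \<Longrightarrow> base y = 0"
  by (simp add: base_def mem_Y_iff)

lemma bounded_operator_base: "bounded_operator_on smul UNIV base"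
  unfolding base_def by (rule bounded_operator_finite_rank) (rule f_dual)

lemma f_in_W: "j \<in> J \<Longrightarrow> f j \<in> W"
  by (simp add: W_def dual.span_base)

lemma W_subset_D: "W \<subseteq> D"
  unfolding W_def by (rule dual.span_minimal[OF _ subspace_D]) (use f_dual in auto)

lemma subspace_W: "dual.subspace W"
  unfolding W_def by (rule dual.subspace_span)

lemma W_vanishes_on_Y:
  assumes "g \<in> W" "y \<in> Y"
  shows "blinfun_apply g y = 0"
proof -
  have "dual.subspace {g. blinfun_apply g y = 0}"
    by (rule dual.subspaceI) (simp_all add: blinfun.add_left)
  then have "W \<subseteq> {g. blinfun_apply g y = 0}"
    unfolding W_def by (rule dual.span_minimal[rotated]) (use assms(2) in \<open>auto simp: mem_Y_iff\<close>)
  with assms(1) show ?thesis by blast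
qed

lemma apply_base:
  assumes "g \<in> D" "\<And>y. y \<in> Y \<Longrightarrow> blinfun_apply g y = 0"
  shows "blinfun_apply g (base x) = blinfun_apply g x"
  using assms(2)[OF diff_base_in_Y[of x]] by (simp add: blinfun.diff_right)

lemma expansion_of_annihilator:
  assumes "g \<in> D" "\<And>y. y \<in> Y \<Longrightarrow> blinfun_apply g y = 0"
  shows "g = (\<Sum>j\<in>J. dual_smul (blinfun_apply g (b j)) (f j))"
proof (rule blinfun_eqI)
  fix x
  have "blinfun_apply g x = blinfun_apply g (base x)" using apply_base[OF assms] by simp
  then show "blinfun_apply g x = blinfun_apply (\<Sum>j\<in>J. dual_smul (blinfun_apply g (b j)) (f j)) x"
    by (simp add: base_def blinfun.sum_right blinfun.sum_left dual_apply_smul assms(1) mult.commute)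
qed

lemma annihilator_in_W:
  assumes "g \<in> D" "\<And>y. y \<in> Y \<Longrightarrow> blinfun_apply g y = 0"
  shows "g \<in> W"
proof -
  have "(\<Sum>j\<in>J. dual_smul (blinfun_apply g (b j)) (f j)) \<in> W"
    by (intro dual.subspace_sum[OF subspace_W] dual.subspace_scale[OF subspace_W] f_in_W)
  with expansion_of_annihilator[OF assms] show ?thesis by simp
qed

text \<open>
  The operators \<open>Id - P\<close> for projections \<open>P\<close> onto \<open>Y\<close>.\<close>

definition complementary :: "('a \<Rightarrow> 'a) \<Rightarrow> bool" where
  "complementary F \<longleftrightarrow> bounded_operator_on smul UNIV F \<and> (\<forall>y\<in>Y. F y = 0) \<and> (\<forall>x. x - F x \<in> Y)"

lemma projection_onto_Y_iff:
  "projection_onto smul Y UNIV P \<longleftrightarrow> complementary (\<lambda>x. x - P x)"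
proof -
  have "bounded_operator_on smul UNIV P \<longleftrightarrow> bounded_operator_on smul UNIV (\<lambda>x. x - P x)"
    using bounded_operator_on_diff[OF bounded_operator_on_id, of P]
      bounded_operator_on_diff[OF bounded_operator_on_id, of "\<lambda>x. x - P x"] by auto
  then show ?thesis by (auto simp: projection_onto_def complementary_def)
qed

lemma complementary_base: "complementary base"
  using bounded_operator_base base_vanishes_on_Y diff_base_in_Y by (simp add: complementary_def)

lemma complementary_apply:
  assumes "complementary F"
  shows "F (base x) = F x" and "F x = (\<Sum>j\<in>J. smul (blinfun_apply (f j) x) (F (b j)))"
    and "j \<in> J \<Longrightarrow> blinfun_apply (f j) (F x) = blinfun_apply (f j) x"
proof -
  have F: "bounded_operator_on smul UNIV F" using assms by (simp add: complementary_def)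
  note linear_F = bounded_linear.linear[OF bounded_linear_of_bounded_operator[OF F]]
  have F_smul: "F (smul c x) = smul c (F x)" for c x
    using F unfolding bounded_operator_on_def by blast
  have "F (x - base x) = 0" using assms diff_base_in_Y by (simp add: complementary_def)
  then show eq: "F (base x) = F x" by (simp add: linear_diff[OF linear_F])
  show "F x = (\<Sum>j\<in>J. smul (blinfun_apply (f j) x) (F (b j)))"
    unfolding eq[symmetric] by (simp add: base_def linear_sum[OF linear_F] F_smul)
  show "blinfun_apply (f j) (F x) = blinfun_apply (f j) x" if "j \<in> J"
  proof -
    have "x - F x \<in> Y" using assms by (simp add: complementary_def)
    then show ?thesis using that by (simp add: mem_Y_iff blinfun.diff_right)
  qed
qed

lemma opnorm_on_id_minus_complementary:
  assumes daugavet: "daugavet_property smul" and "J \<noteq> {}" and F: "complementary F"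
  shows "opnorm_on UNIV (\<lambda>x. x - F x) = 1 + opnorm_on UNIV F"
proof -
  have op: "bounded_operator_on smul UNIV F" using F by (simp add: complementary_def)
  have apply_F: "blinfun_apply (Blinfun F) = F"
    by (rule bounded_linear_Blinfun_apply[OF bounded_linear_of_bounded_operator[OF op]])
  have op': "bounded_operator_on smul UNIV (\<lambda>x. x - F x)"
    by (rule bounded_operator_on_diff[OF bounded_operator_on_id op])
  have apply_P: "blinfun_apply (Blinfun (\<lambda>x. x - F x)) = (\<lambda>x. x - F x)"
    by (rule bounded_linear_Blinfun_apply[OF bounded_linear_of_bounded_operator[OF op']])
  obtain j where j: "j \<in> J" using \<open>J \<noteq> {}\<close> by blast
  have "blinfun_apply (f j) (F (b j)) = 1"
    by (simp add: complementary_apply(3)[OF F j] biorthogonal j)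
  then have "F (b j) \<noteq> 0" by auto
  then have "Blinfun F \<noteq> 0" using apply_F by auto
  have "norm (id_blinfun + - Blinfun F) = 1 + norm (- Blinfun F)"
  proof (rule daugavet_finite_rank[OF daugavet finite_J f_dual])
    show "blinfun_apply (- Blinfun F) x = (\<Sum>j\<in>J. smul (blinfun_apply (f j) x) (- F (b j)))" for x
      using complementary_apply(2)[OF F, of x] by (simp add: apply_F blinfun.minus_left sum_negf)
    show "- Blinfun F \<noteq> 0" using \<open>Blinfun F \<noteq> 0\<close> by simp
  qed
  moreover have "id_blinfun + - Blinfun F = Blinfun (\<lambda>x. x - F x)"
    by (rule blinfun_eqI) (simp add: apply_F apply_P blinfun.diff_left)
  ultimately show ?thesis by (simp add: opnorm_on_UNIV op op')
qed

lemma
  assumes F: "complementary F"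
  shows projection_onto_adjoint: "projection_onto dual_smul W D (adjoint_operator smul F)"
    and weak_star_continuous_adjoint:
      "continuous_map (weak_star_topology smul) (top_of_set W) (adjoint_operator smul F)"
proof -
  let ?Q = "adjoint_operator smul F"
  have op: "bounded_operator_on smul UNIV F" and F0: "\<And>y. y \<in> Y \<Longrightarrow> F y = 0"
    using F by (auto simp: complementary_def)
  note apply_Q = adjoint_operator_apply[OF normed_space_over_axioms op]
  have Q_W: "?Q g \<in> W" if "g \<in> D" for g
    by (rule annihilator_in_W) (simp_all add: adjoint_in_dual_space[OF op that] apply_Q that F0)
  have Q_id: "?Q g = g" if "g \<in> W" for g
  proof (rule blinfun_eqI)
    fix x
    have g: "g \<in> D" using that W_subset_D by blast
    have "x - F x \<in> Y" using F by (simp add: complementary_def)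
    from W_vanishes_on_Y[OF that this] show "blinfun_apply (?Q g) x = blinfun_apply g x"
      by (simp add: apply_Q[OF g] blinfun.diff_right)
  qed
  have "?Q \<in> D \<rightarrow>\<^sub>E W"
    using Q_W by (auto simp: adjoint_operator_def)
  then show "projection_onto dual_smul W D ?Q"
    using bounded_operator_on_adjoint[OF op] Q_id by (simp add: projection_onto_def)
  have topspace: "topspace (weak_star_topology smul) = D"
    by (simp add: weak_star_topology_def topspace_pullback_topology)
  define \<Phi> where "\<Phi> h = (\<Sum>j\<in>J. dual_smul (h (F (b j))) (f j))" for h :: "'a \<Rightarrow> 'k"
  have "continuous_on UNIV \<Phi>"
    unfolding \<Phi>_def
    by (intro continuous_on_sum bounded_linear.continuous_on[OF dual.bounded_linear_smul_left]
        continuous_on_product_coordinates)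
  then have cont: "continuous_map (weak_star_topology smul) euclidean (\<Phi> \<circ> blinfun_apply)"
    unfolding weak_star_topology_def by (intro continuous_map_pullback) simp
  have "continuous_map (weak_star_topology smul) euclidean ?Q"
  proof (rule continuous_map_eq[OF cont])
    fix g assume "g \<in> topspace (weak_star_topology smul)"
    then have g: "g \<in> D" by (simp add: topspace)
    show "(\<Phi> \<circ> blinfun_apply) g = ?Q g"
    proof (rule blinfun_eqI)
      fix x
      have "blinfun_apply (?Q g) x = blinfun_apply g (\<Sum>j\<in>J. smul (blinfun_apply (f j) x) (F (b j)))"
        unfolding apply_Q[OF g] using complementary_apply(2)[OF F, of x] by simp
      then show "blinfun_apply ((\<Phi> \<circ> blinfun_apply) g) x = blinfun_apply (?Q g) x"
        by (simp add: \<Phi>_def blinfun.sum_left blinfun.sum_right dual_apply_smul g mult.commute)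
    qed
  qed
  then show "continuous_map (weak_star_topology smul) (top_of_set W) ?Q"
    using Q_W by (intro continuous_map_into_subtopology) (auto simp: topspace)
qed

text \<open>
  For fixed \<open>x\<close>, the functional \<open>g \<mapsto> (Q g) x\<close> is weak*-continuous, so it has modulus below 1 on all
  \<open>g\<close> that vanish at certain finitely many points \<open>a\<close>. These \<open>g\<close> form a subspace, on which it must be
  zero. It is therefore a combination of evaluations, that is, evaluation at one point \<open>u x\<close>; the
  points \<open>u (b j)\<close> are the coefficients of \<open>F\<close>.\<close>

lemma weak_star_continuous_projection_is_adjoint:
  assumes Q: "projection_onto dual_smul W D Q"
    and cont: "continuous_map (weak_star_topology smul) (top_of_set W) Q"
  obtains F where "complementary F" "adjoint_operator smul F = Q"
proof -
  have Q_W: "\<And>g. g \<in> D \<Longrightarrow> Q g \<in> W" and Q_id: "\<And>g. g \<in> W \<Longrightarrow> Q g = g"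
    and Q_ext: "\<And>g. g \<notin> D \<Longrightarrow> Q g = undefined"
    and Q_add: "\<And>g h. g \<in> D \<Longrightarrow> h \<in> D \<Longrightarrow> Q (g + h) = Q g + Q h"
    and Q_smul: "\<And>c g. g \<in> D \<Longrightarrow> Q (dual_smul c g) = dual_smul c (Q g)"
    using Q by (auto simp: projection_onto_def bounded_operator_on_def PiE_def extensional_def)
  have "\<exists>u. \<forall>g\<in>D. blinfun_apply (Q g) x = blinfun_apply g u" for x
  proof -
    define l where "l g = blinfun_apply (Q g) x" for g
    have l_smul: "l (dual_smul c g) = c * l g" if "g \<in> D" for c g
      by (simp add: l_def Q_smul that)
    have "continuous_on UNIV (\<lambda>g :: 'a \<Rightarrow>\<^sub>L 'k. blinfun_apply g x)"
      by (intro bounded_linear.continuous_on[OF blinfun.bounded_linear_left] continuous_on_id)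
    moreover have "continuous_map (weak_star_topology smul) euclidean Q"
      using cont by (simp add: continuous_map_in_subtopology)
    ultimately have "continuous_map (weak_star_topology smul) euclidean l"
      using continuous_map_compose[of "weak_star_topology smul" euclidean Q euclidean
          "\<lambda>g. blinfun_apply g x"] by (simp add: l_def[abs_def] o_def)
    then have "openin (weak_star_topology smul)
        {g \<in> topspace (weak_star_topology smul). l g \<in> ball 0 1}"
      by (rule openin_continuous_map_preimage) simp
    then obtain U where U: "open U"
      "{g \<in> topspace (weak_star_topology smul). l g \<in> ball 0 1} = blinfun_apply -` U \<inter> D"
      unfolding weak_star_topology_def openin_pullback_topology by auto
    have l0: "l 0 = 0" using l_smul[of 0 0] dual.subspace_0[OF subspace_D] by simp
    have U_iff: "blinfun_apply g \<in> U \<longleftrightarrow> norm (l g) < 1" if "g \<in> D" for g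
      using U(2) that by (auto simp: weak_star_topology_def topspace_pullback_topology set_eq_iff)
    have "openin (product_topology (\<lambda>i::'a. euclidean :: 'k topology) UNIV) U"
      using U(1) by (simp add: open_fun_def)
    moreover have "blinfun_apply 0 \<in> U" using U_iff[of 0] l0 dual.subspace_0[OF subspace_D] by simp
    ultimately have "\<exists>X. blinfun_apply (0 :: 'a \<Rightarrow>\<^sub>L 'k) \<in> (\<Pi>\<^sub>E i\<in>UNIV. X i) \<and>
        (\<forall>i. openin euclidean (X i)) \<and> finite {i. X i \<noteq> topspace euclidean} \<and> (\<Pi>\<^sub>E i\<in>UNIV. X i) \<subseteq> U"
      by (rule product_topology_open_contains_basis)
    then obtain X where X: "blinfun_apply (0 :: 'a \<Rightarrow>\<^sub>L 'k) \<in> (\<Pi>\<^sub>E i\<in>UNIV. X i)"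
      "finite {i. X i \<noteq> UNIV}" "(\<Pi>\<^sub>E i\<in>UNIV. X i) \<subseteq> U"
      unfolding topspace_euclidean by blast
    define A where "A = {i. X i \<noteq> UNIV}"
    have small: "norm (l g) < 1" if g: "g \<in> D" and A: "\<And>a. a \<in> A \<Longrightarrow> blinfun_apply g a = 0" for g
    proof -
      have "blinfun_apply g i \<in> X i" for i
        using X(1) A[of i] by (cases "i \<in> A") (auto simp: A_def PiE_def Pi_def)
      then have "blinfun_apply g \<in> (\<Pi>\<^sub>E i\<in>UNIV. X i)" by auto
      with X(3) U_iff[OF g] show ?thesis by blast
    qed
    have "\<exists>c. \<forall>g\<in>D. l g = (\<Sum>a\<in>A. c a * blinfun_apply g a)"
    proof (rule dual.functional_vanishing_on_common_kernel[OF _ subspace_D])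
      show "finite A" using X(2) by (simp add: A_def)
      show "l (g + h) = l g + l h" if "g \<in> D" "h \<in> D" for g h
        by (simp add: l_def Q_add that blinfun.add_left)
      show "l g = 0" if g: "g \<in> D" and A: "\<And>a. a \<in> A \<Longrightarrow> blinfun_apply g a = 0" for g
      proof (rule ccontr)
        assume "l g \<noteq> 0"
        then have "l (dual_smul (inverse (l g)) g) = 1" by (simp add: l_smul g)
        moreover have "norm (l (dual_smul (inverse (l g)) g)) < 1"
          by (rule small) (simp_all add: A dual.subspace_scale[OF subspace_D g])
        ultimately show False by simp
      qed
    qed (simp_all add: blinfun.add_left l_smul)
    then obtain c where c: "\<And>g. g \<in> D \<Longrightarrow> l g = (\<Sum>a\<in>A. c a * blinfun_apply g a)" by blast
    have "blinfun_apply (Q g) x = blinfun_apply g (\<Sum>a\<in>A. smul (c a) a)" if "g \<in> D" for g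
      using c[OF that] by (simp add: l_def blinfun.sum_right dual_apply_smul that)
    then show ?thesis by blast
  qed
  then obtain u where u: "\<And>x g. g \<in> D \<Longrightarrow> blinfun_apply (Q g) x = blinfun_apply g (u x)" by metis
  define F where "F x = (\<Sum>j\<in>J. smul (blinfun_apply (f j) x) (u (b j)))" for x
  have op: "bounded_operator_on smul UNIV F"
    unfolding F_def by (rule bounded_operator_finite_rank) (rule f_dual)
  have apply_F: "blinfun_apply g (F x) = blinfun_apply (Q g) x" if g: "g \<in> D" for g x
  proof -
    have Qg: "Q g \<in> W" by (rule Q_W[OF g])
    have "blinfun_apply (Q g) x = blinfun_apply (Q g) (base x)"
      using apply_base[of "Q g"] W_vanishes_on_Y[OF Qg] Qg W_subset_D by auto
    also have "\<dots> = (\<Sum>j\<in>J. blinfun_apply (f j) x * blinfun_apply (Q g) (b j))"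
      using Qg W_subset_D by (auto simp: base_def blinfun.sum_right dual_apply_smul)
    also have "\<dots> = blinfun_apply g (F x)"
      by (simp add: F_def blinfun.sum_right dual_apply_smul g u)
    finally show ?thesis by simp
  qed
  show ?thesis
  proof (rule that)
    show "complementary F"
      unfolding complementary_def
    proof (intro conjI op ballI allI)
      show "F y = 0" if "y \<in> Y" for y using that by (simp add: F_def mem_Y_iff)
      show "x - F x \<in> Y" for x
        by (simp add: mem_Y_iff blinfun.diff_right apply_F f_dual Q_id f_in_W)
    qed
    show "adjoint_operator smul F = Q"
    proof
      fix g
      show "adjoint_operator smul F g = Q g"
      proof (cases "g \<in> D")
        case True
        show ?thesis
          by (rule blinfun_eqI)
             (simp add: adjoint_operator_apply[OF normed_space_over_axioms op True] apply_F True)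
      qed (simp add: adjoint_operator_def Q_ext)
    qed
  qed
qed

end

section \<open>Local reflexivity\<close>

text \<open>
  The coordinates \<open>f j x\<close> of the ball are bounded; cutting their range into squares of side \<open>\<delta> / 2\<close>
  leaves finitely many cells, and one representative of each cell that meets the ball suffices.\<close>

lemma finite_net_for_functionals:
  fixes f :: "'i \<Rightarrow> 'a::real_normed_vector \<Rightarrow>\<^sub>L 'k::real_or_complex"
  assumes J: "finite J" and "0 < \<delta>"
  obtains A where "finite A" "A \<subseteq> cball 0 1"
    "\<And>x. norm x \<le> 1 \<Longrightarrow> \<exists>a\<in>A. \<forall>j\<in>J. norm (blinfun_apply (f j) (x - a)) \<le> \<delta>"
proof -
  define r where "r = \<delta> / 2"
  have r: "0 < r" using \<open>0 < \<delta>\<close> by (simp add: r_def)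
  define B where "B = (\<Sum>j\<in>J. norm (f j))"
  define m where "m = \<lceil>B / r\<rceil>"
  define cell where "cell a = (\<lfloor>re a / r\<rfloor>, \<lfloor>re (imag_unit * a) / r\<rfloor>)" for a :: 'k
  define key where "key x = (\<lambda>j\<in>J. cell (blinfun_apply (f j) x))" for x
  have floor_range: "\<lfloor>s / r\<rfloor> \<in> {- m - 1..m}" if "\<bar>s\<bar> \<le> B" for s
  proof -
    have "\<bar>s / r\<bar> \<le> B / r" using that r by (simp add: divide_right_mono)
    also have "\<dots> \<le> real_of_int m" by (simp add: m_def)
    finally have "- real_of_int m \<le> s / r" "s / r \<le> real_of_int m" by linarith+
    then show ?thesis by (simp add: floor_le_iff le_floor_iff)
  qed
  have cell_range: "cell (blinfun_apply (f j) x) \<in> {- m - 1..m} \<times> {- m - 1..m}"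
    if "j \<in> J" "norm x \<le> 1" for j x
  proof -
    have "norm (blinfun_apply (f j) x) \<le> norm (f j)"
      using norm_blinfun[of "f j" x] mult_left_mono[OF that(2), of "norm (f j)"] by simp
    also have "\<dots> \<le> B" unfolding B_def by (rule member_le_sum[OF that(1)]) (simp_all add: J)
    finally have le: "norm (blinfun_apply (f j) x) \<le> B" .
    have "norm (imag_unit * blinfun_apply (f j) x) \<le> 1 * norm (blinfun_apply (f j) x)"
      unfolding norm_mult by (rule mult_right_mono[OF norm_imag_unit_le]) simp
    with le have "\<bar>re (blinfun_apply (f j) x)\<bar> \<le> B" "\<bar>re (imag_unit * blinfun_apply (f j) x)\<bar> \<le> B"
      using abs_re_le[of "blinfun_apply (f j) x"] abs_re_le[of "imag_unit * blinfun_apply (f j) x"]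
      by linarith+
    then show ?thesis unfolding cell_def by (intro SigmaI floor_range)
  qed
  have "key ` cball 0 1 \<subseteq> (\<Pi>\<^sub>E j\<in>J. {- m - 1..m} \<times> {- m - 1..m})"
    using cell_range unfolding key_def by (intro image_subsetI restrict_PiE_iff[THEN iffD2]) auto
  moreover have "finite (\<Pi>\<^sub>E j\<in>J. {- m - 1..m} \<times> {- m - 1..m})"
    using J by (intro finite_PiE) auto
  ultimately have fin: "finite (key ` cball 0 1)" by (rule finite_subset)
  define rep where "rep v = (SOME a. a \<in> cball 0 1 \<and> key a = v)" for v
  have rep: "rep v \<in> cball 0 1 \<and> key (rep v) = v" if v: "v \<in> key ` cball 0 1" for v
    unfolding rep_def by (rule someI_ex) (use v in blast)
  have floor_close: "\<bar>s - t\<bar> \<le> r" if "\<lfloor>s / r\<rfloor> = \<lfloor>t / r\<rfloor>" for s t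
  proof -
    have "\<bar>s / r - t / r\<bar> \<le> 1" using that by linarith
    then have "\<bar>(s - t) / r\<bar> \<le> 1" by (simp add: diff_divide_distrib)
    then show ?thesis using r by simp
  qed
  show ?thesis
  proof (rule that[of "rep ` key ` cball 0 1"])
    show "finite (rep ` key ` cball 0 1)" using fin by simp
    show "rep ` key ` cball 0 1 \<subseteq> cball 0 1" using rep by blast
    fix x :: 'a assume "norm x \<le> 1"
    then have x: "key x \<in> key ` cball 0 1" by simp
    define a where "a = rep (key x)"
    have key: "key a = key x" using rep[OF x] by (simp add: a_def)
    have "norm (blinfun_apply (f j) (x - a)) \<le> \<delta>" if j: "j \<in> J" for j
    proof -
      have "cell (blinfun_apply (f j) x) = cell (blinfun_apply (f j) a)"
        using fun_cong[OF key, of j] j by (simp add: key_def)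
      then have "\<bar>re (blinfun_apply (f j) x) - re (blinfun_apply (f j) a)\<bar> \<le> r"
        "\<bar>re (imag_unit * blinfun_apply (f j) x) - re (imag_unit * blinfun_apply (f j) a)\<bar> \<le> r"
        by (auto simp: cell_def intro!: floor_close)
      then show ?thesis
        using norm_le_re_parts[of "blinfun_apply (f j) (x - a)"]
        by (simp add: blinfun.diff_right re_minus right_diff_distrib r_def)
    qed
    moreover have "a \<in> rep ` key ` cball 0 1" unfolding a_def using x by (rule imageI)
    ultimately show "\<exists>a\<in>rep ` key ` cball 0 1. \<forall>j\<in>J. norm (blinfun_apply (f j) (x - a)) \<le> \<delta>"
      by blast
  qed
qed

text \<open>
  The power \<open>X\<^sup>N\<close> with the maximum norm, realised inside the bounded sequences in \<open>X\<close>.\<close>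

definition finite_sequence :: "nat \<Rightarrow> (nat \<Rightarrow> 'a) \<Rightarrow> nat \<Rightarrow>\<^sub>C 'a::real_normed_vector" where
  "finite_sequence N s = Bcontfun (\<lambda>k. if k < N then s k else 0)"

lemma apply_finite_sequence:
  "apply_bcontfun (finite_sequence N s) k = (if k < N then s k else 0)"
proof -
  have "(\<lambda>k. if k < N then s k else 0) \<in> bcontfun"
  proof (rule bcontfun_normI[of _ "\<Sum>k<N. norm (s k)"])
    show "norm (if k < N then s k else 0) \<le> (\<Sum>k<N. norm (s k))" for k
      by (auto intro!: member_le_sum sum_nonneg)
  qed simp
  then show ?thesis by (simp add: finite_sequence_def Bcontfun_inverse)
qed

lemma finite_sequence_add:
  "finite_sequence N s + finite_sequence N t = finite_sequence N (\<lambda>k. s k + t k)"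
  by (rule bcontfun_eqI) (simp add: apply_finite_sequence)

lemma finite_sequence_scaleR: "r *\<^sub>R finite_sequence N s = finite_sequence N (\<lambda>k. r *\<^sub>R s k)"
  by (rule bcontfun_eqI) (simp add: apply_finite_sequence)

lemma norm_finite_sequence_le:
  assumes "0 \<le> B" "\<And>k. k < N \<Longrightarrow> norm (s k) \<le> B"
  shows "norm (finite_sequence N s) \<le> B"
  by (rule norm_bound) (simp add: apply_finite_sequence assms)

lemma norm_le_norm_finite_sequence: "k < N \<Longrightarrow> norm (s k) \<le> norm (finite_sequence N s)"
  using norm_bounded[of "finite_sequence N s" k] by (simp add: apply_finite_sequence)

context normed_space_over begin

text \<open>
  The dual of \<open>\<ell>\<^sub>\<infinity>\<close>-sums is the \<open>\<ell>\<^sub>1\<close>-sum of the duals: choosing each entry to almost norm \<open>g k\<close>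
  gives one sequence of norm at most 1 on which \<open>\<Lambda>\<close> is almost \<open>\<Sum>\<parallel>g k\<parallel>\<close>.\<close>

lemma functional_on_finite_sequences:
  fixes \<Lambda> :: "(nat \<Rightarrow>\<^sub>C 'a) \<Rightarrow> real"
  assumes \<Lambda>: "linear \<Lambda>" "\<And>z. \<Lambda> z \<le> norm z"
  obtains g where "\<And>k. g k \<in> dual_space smul" "(\<Sum>k<N. norm (g k)) \<le> 1"
    "\<And>s. \<Lambda> (finite_sequence N s) = (\<Sum>k<N. re (blinfun_apply (g k) (s k)))"
proof -
  define single where "single k v = finite_sequence N (\<lambda>i. if i = k then v else 0)" for k and v :: 'a
  have "\<exists>g\<in>dual_space smul. \<forall>v. re (blinfun_apply g v) = \<Lambda> (single k v)" for k
  proof -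
    have "linear (\<lambda>v. \<Lambda> (single k v))"
    proof (rule linearI)
      have "single k (v + w) = single k v + single k w" for v w
        by (rule bcontfun_eqI) (simp add: single_def apply_finite_sequence)
      then show "\<Lambda> (single k (v + w)) = \<Lambda> (single k v) + \<Lambda> (single k w)" for v w
        by (simp add: linear_add[OF \<Lambda>(1)])
      have "single k (r *\<^sub>R v) = r *\<^sub>R single k v" for r v
        by (rule bcontfun_eqI) (simp add: single_def apply_finite_sequence)
      then show "\<Lambda> (single k (r *\<^sub>R v)) = r *\<^sub>R \<Lambda> (single k v)" for r v
        by (simp add: linear_cmul[OF \<Lambda>(1)])
    qed
    moreover have "\<Lambda> (single k v) \<le> 1 * norm v" for v
    proof -
      have "norm (single k v) \<le> norm v"
        unfolding single_def by (rule norm_finite_sequence_le) auto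
      with \<Lambda>(2)[of "single k v"] show ?thesis by simp
    qed
    ultimately obtain g where "g \<in> dual_space smul" "\<And>v. re (blinfun_apply g v) = \<Lambda> (single k v)"
      using dual_functional_of_real_part[of _ 1] by (metis zero_le_one)
    then show ?thesis by blast
  qed
  then obtain g where g: "\<And>k. g k \<in> dual_space smul"
    and re_g: "\<And>k v. re (blinfun_apply (g k) v) = \<Lambda> (single k v)" by metis
  have expand: "\<Lambda> (finite_sequence N s) = (\<Sum>k<N. re (blinfun_apply (g k) (s k)))" for s
  proof -
    have sum_apply: "apply_bcontfun (\<Sum>k<M. single k (s k)) i = (\<Sum>k<M. apply_bcontfun (single k (s k)) i)"
      for M i by (induction M) simp_all
    have "finite_sequence N s = (\<Sum>k<N. single k (s k))"
    proof (rule bcontfun_eqI)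
      fix i
      have "(\<Sum>k<N. apply_bcontfun (single k (s k)) i) = (\<Sum>k<N. if k = i then s k else 0)"
        by (rule sum.cong) (auto simp: single_def apply_finite_sequence)
      then show "apply_bcontfun (finite_sequence N s) i = apply_bcontfun (\<Sum>k<N. single k (s k)) i"
        by (simp add: sum_apply apply_finite_sequence)
    qed
    then show ?thesis by (simp add: linear_sum[OF \<Lambda>(1)] re_g)
  qed
  have "(\<Sum>k<N. norm (g k)) \<le> 1"
  proof (rule field_le_epsilon)
    fix \<epsilon> :: real assume \<epsilon>: "0 < \<epsilon>"
    define \<eta> where "\<eta> = \<epsilon> / real (Suc N)"
    have \<eta>: "0 < \<eta>" "real N * \<eta> \<le> \<epsilon>" using \<epsilon> by (auto simp: \<eta>_def field_simps)
    have "\<exists>v. norm v \<le> 1 \<and> norm (g k) - \<eta> \<le> re (blinfun_apply (g k) v)" for k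
      by (rule dual_norm_nearly_attained[OF g \<eta>(1)]) blast
    then obtain v where v: "\<And>k. norm (v k) \<le> 1" "\<And>k. norm (g k) - \<eta> \<le> re (blinfun_apply (g k) (v k))"
      by metis
    have "(\<Sum>k<N. norm (g k) - \<eta>) \<le> (\<Sum>k<N. re (blinfun_apply (g k) (v k)))"
      by (intro sum_mono v)
    also have "\<dots> \<le> norm (finite_sequence N v)" unfolding expand[symmetric] by (rule \<Lambda>(2))
    also have "\<dots> \<le> 1" by (rule norm_finite_sequence_le) (simp_all add: v)
    finally show "(\<Sum>k<N. norm (g k)) \<le> 1 + \<epsilon>" using \<eta>(2) by (simp add: sum_subtractf)
  qed
  with g expand that show ?thesis by blast
qed

end

context biorthogonal_system begin

lemma complementary_add:
  assumes "complementary F" and S: "bounded_operator_on smul UNIV S"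
    and "\<And>y. y \<in> Y \<Longrightarrow> S y = 0" "\<And>x. S x \<in> Y"
  shows "complementary (\<lambda>x. F x + S x)"
proof -
  have F: "bounded_operator_on smul UNIV F" using assms(1) by (simp add: complementary_def)
  have "bounded_operator_on smul UNIV (\<lambda>x. F x + S x)"
    by (rule bounded_operator_onI)
       (use F S in \<open>simp_all add: bounded_operator_on_UNIV_iff bounded_linear_add scale_right_distrib\<close>)
  moreover have "x - (F x + S x) \<in> Y" for x
  proof -
    have "x - F x \<in> Y" using assms(1) by (simp add: complementary_def)
    from subspace_diff[OF subspace_Y this assms(4)[of x]] show ?thesis by (simp add: algebra_simps)
  qed
  ultimately show ?thesis using assms by (simp add: complementary_def)
qed

lemma functional_vanishing_on_Y_of_real_part:
  assumes g: "g \<in> D" and re0: "\<And>u. u \<in> Y \<Longrightarrow> re (blinfun_apply g u) = 0" and "y \<in> Y"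
  shows "blinfun_apply g y = 0"
proof -
  obtain \<theta> where \<theta>: "\<theta> * blinfun_apply g y = of_real (norm (blinfun_apply g y))"
    by (rule unimodular_rotation)
  have "re (blinfun_apply g (smul \<theta> y)) = 0"
    by (rule re0[OF subspace_scale[OF subspace_Y \<open>y \<in> Y\<close>]])
  then show ?thesis by (simp add: dual_apply_smul[OF g] \<theta> re_of_real)
qed

text \<open>
  Trace duality. All \<open>base + S\<close> with \<open>S\<close> as in the hypothesis are complementary. If their values
  at the points \<open>xs k\<close> stay away from 0 by \<open>d\<close>, the separating functional is given by \<open>g k\<close> and
  vanishes on \<open>S = f j \<otimes> u\<close> for \<open>u \<in> Y\<close>, which means that \<open>G j = \<Sum>\<^sub>k f j (xs k) g k\<close> annihilates
  \<open>Y\<close> and lies in \<open>W\<close>. Then \<open>Q (G j) = G j\<close>, and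
  \<open>\<Sum>\<^sub>k g k (base (xs k)) = \<Sum>\<^sub>j (G j) (b j) = \<Sum>\<^sub>j (Q (G j)) (b j) = \<Sum>\<^sub>k (Q (g k)) (xs k)\<close>.\<close>

lemma distance_bound_from_projection:
  assumes Q: "projection_onto dual_smul W D Q"
    and xs: "\<And>k. k < N \<Longrightarrow> norm (xs k) \<le> 1" and "0 \<le> d"
    and d: "\<And>S. bounded_operator_on smul UNIV S \<Longrightarrow> (\<forall>y\<in>Y. S y = 0) \<Longrightarrow> (\<forall>x. S x \<in> Y) \<Longrightarrow>
      d \<le> norm (finite_sequence N (\<lambda>k. base (xs k) + S (xs k)))"
  shows "d \<le> opnorm_on D Q"
proof -
  have Q_W: "\<And>g. g \<in> D \<Longrightarrow> Q g \<in> W" and Q_id: "\<And>g. g \<in> W \<Longrightarrow> Q g = g"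
    and Q_add: "\<And>g h. g \<in> D \<Longrightarrow> h \<in> D \<Longrightarrow> Q (g + h) = Q g + Q h"
    and Q_smul: "\<And>c g. g \<in> D \<Longrightarrow> Q (dual_smul c g) = dual_smul c (Q g)"
    and op: "bounded_operator_on dual_smul D Q"
    using Q by (auto simp: projection_onto_def bounded_operator_on_def PiE_def)
  define \<S> where "\<S> = {S. bounded_operator_on smul UNIV S \<and> (\<forall>y\<in>Y. S y = 0) \<and> (\<forall>x. S x \<in> Y)}"
  define sample where "sample S = finite_sequence N (\<lambda>k. S (xs k))" for S :: "'a \<Rightarrow> 'a"
  have L: "real_vector.subspace (sample ` \<S>)"
  proof (rule real_vector.subspaceI)
    have "(\<lambda>x. 0) \<in> \<S>"
      by (simp add: \<S>_def subspace_0[OF subspace_Y] bounded_operator_on_UNIV_iff)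
    moreover have "sample (\<lambda>x. 0) = 0"
      by (rule bcontfun_eqI) (simp add: sample_def apply_finite_sequence)
    ultimately show "0 \<in> sample ` \<S>" by (metis imageI)
  next
    fix z w assume "z \<in> sample ` \<S>" "w \<in> sample ` \<S>"
    then obtain S T where S: "S \<in> \<S>" "z = sample S" and T: "T \<in> \<S>" "w = sample T" by blast
    have "(\<lambda>x. S x + T x) \<in> \<S>"
      using S(1) T(1) by (auto simp: \<S>_def subspace_add[OF subspace_Y] bounded_operator_on_UNIV_iff
          bounded_linear_add scale_right_distrib)
    moreover have "z + w = sample (\<lambda>x. S x + T x)"
      by (simp add: S T sample_def finite_sequence_add)
    ultimately show "z + w \<in> sample ` \<S>" by blast
  next
    fix z r assume "z \<in> sample ` \<S>"
    then obtain S where S: "S \<in> \<S>" "z = sample S" by blast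
    have "(\<lambda>x. r *\<^sub>R S x) \<in> \<S>"
    proof -
      have "r *\<^sub>R smul c v = smul c (r *\<^sub>R v)" for c v
        unfolding smul_of_real[symmetric] by (rule scale_left_commute)
      moreover have "r *\<^sub>R y \<in> Y" if "y \<in> Y" for y
        using subspace_scale[OF subspace_Y that, of "of_real r"] by (simp add: smul_of_real)
      ultimately show ?thesis
        using S(1) by (auto simp: \<S>_def bounded_operator_on_UNIV_iff bounded_linear_const_scaleR)
    qed
    moreover have "r *\<^sub>R z = sample (\<lambda>x. r *\<^sub>R S x)"
      by (simp add: S sample_def finite_sequence_scaleR)
    ultimately show "r *\<^sub>R z \<in> sample ` \<S>" by blast
  qed
  have dist: "d \<le> norm (sample base + z)" if "z \<in> sample ` \<S>" for z
    using that d by (auto simp: \<S>_def sample_def finite_sequence_add)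
  obtain \<Lambda> where \<Lambda>: "linear \<Lambda>" "\<And>z. \<Lambda> z \<le> norm z" "\<And>z. z \<in> sample ` \<S> \<Longrightarrow> \<Lambda> z = 0"
    "d \<le> \<Lambda> (sample base)"
    using distance_functional_exists[OF L dist \<open>0 \<le> d\<close>] by blast
  obtain g where g: "\<And>k. g k \<in> D" "(\<Sum>k<N. norm (g k)) \<le> 1"
    and \<Lambda>_g: "\<And>s. \<Lambda> (finite_sequence N s) = (\<Sum>k<N. re (blinfun_apply (g k) (s k)))"
    using functional_on_finite_sequences[OF \<Lambda>(1,2)] by blast
  define G where "G j = (\<Sum>k<N. dual_smul (blinfun_apply (f j) (xs k)) (g k))" for j
  have re_sum: "re (sum a K) = (\<Sum>k\<in>K. re (a k))" if "finite K" for a :: "nat \<Rightarrow> 'k" and K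
    using that by (induction K) (simp_all add: re_add re_of_real[of 0, simplified])
  have G_D: "G j \<in> D" for j
    unfolding G_def by (intro dual.subspace_sum[OF subspace_D] dual.subspace_scale[OF subspace_D] g)
  have G_W: "G j \<in> W" if j: "j \<in> J" for j
  proof (rule annihilator_in_W[OF G_D functional_vanishing_on_Y_of_real_part[OF G_D]])
    fix u assume u: "u \<in> Y"
    have "(\<lambda>x. smul (blinfun_apply (f j) x) u) \<in> \<S>"
    proof -
      have "bounded_operator_on smul UNIV (\<lambda>x. smul (blinfun_apply (f j) x) u)"
        using bounded_operator_finite_rank[of "{j}" f "\<lambda>_. u"] f_dual[OF j] by simp
      then show ?thesis using j u
        by (simp add: \<S>_def mem_Y_iff dual_apply_smul f_dual)
    qed
    then have "0 = \<Lambda> (sample (\<lambda>x. smul (blinfun_apply (f j) x) u))" using \<Lambda>(3) by simp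
    also have "\<dots> = re (blinfun_apply (G j) u)"
      by (simp add: sample_def \<Lambda>_g G_def blinfun.sum_left re_sum dual_apply_smul[OF g(1)])
    finally show "re (blinfun_apply (G j) u) = 0" by simp
  qed
  have Q_sum: "Q (\<Sum>k<M. dual_smul (a k) (g k)) = (\<Sum>k<M. dual_smul (a k) (Q (g k)))" for a M
  proof (induction M)
    case 0
    then show ?case using Q_smul[of 0 0] dual.subspace_0[OF subspace_D] by simp
  next
    case (Suc M)
    have "(\<Sum>k<M. dual_smul (a k) (g k)) \<in> D" "dual_smul (a M) (g M) \<in> D"
      by (intro dual.subspace_sum[OF subspace_D] dual.subspace_scale[OF subspace_D] g)+
    then show ?case by (simp add: Q_add Q_smul g Suc)
  qed
  have Qg_base: "blinfun_apply (Q (g k)) (base x) = blinfun_apply (Q (g k)) x" for k x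
    using Q_W[OF g(1)] W_subset_D W_vanishes_on_Y by (intro apply_base) auto
  have Qg_D: "Q (g k) \<in> D" for k using Q_W[OF g(1)] W_subset_D by blast
  have "(\<Sum>k<N. blinfun_apply (g k) (base (xs k))) = (\<Sum>j\<in>J. blinfun_apply (G j) (b j))"
    unfolding base_def G_def blinfun.sum_left blinfun.sum_right dual_smul_apply
    by (subst sum.swap) (simp add: dual_apply_smul[OF g(1)])
  also have "\<dots> = (\<Sum>j\<in>J. blinfun_apply (Q (G j)) (b j))"
    by (intro sum.cong refl) (simp add: Q_id G_W)
  also have "\<dots> = (\<Sum>k<N. blinfun_apply (Q (g k)) (base (xs k)))"
    unfolding base_def G_def Q_sum blinfun.sum_left blinfun.sum_right dual_smul_apply
    by (subst sum.swap) (simp add: dual_apply_smul[OF Qg_D])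
  finally have trace: "(\<Sum>k<N. blinfun_apply (g k) (base (xs k)))
      = (\<Sum>k<N. blinfun_apply (Q (g k)) (xs k))" by (simp add: Qg_base)
  note Q0 = dual.opnorm_on_nonneg[OF op subspace_D]
  have "d \<le> re (\<Sum>k<N. blinfun_apply (g k) (base (xs k)))"
    using \<Lambda>(4) by (simp add: sample_def \<Lambda>_g re_sum)
  also have "\<dots> \<le> norm (\<Sum>k<N. blinfun_apply (Q (g k)) (xs k))"
    unfolding trace using abs_re_le by (rule order_trans[OF abs_ge_self])
  also have "\<dots> \<le> (\<Sum>k<N. opnorm_on D Q * norm (g k))"
  proof (rule sum_norm_le)
    fix k assume "k \<in> {..<N}"
    then have x: "norm (xs k) \<le> 1" using xs by simp
    have "norm (blinfun_apply (Q (g k)) (xs k)) \<le> norm (Q (g k)) * norm (xs k)" by (rule norm_blinfun)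
    also have "\<dots> \<le> norm (Q (g k)) * 1" by (rule mult_left_mono[OF x]) simp
    also have "\<dots> \<le> opnorm_on D Q * norm (g k)"
      using dual.norm_le_opnorm_on[OF op subspace_D g(1)] by simp
    finally show "norm (blinfun_apply (Q (g k)) (xs k)) \<le> opnorm_on D Q * norm (g k)" .
  qed
  also have "\<dots> \<le> opnorm_on D Q * 1"
    unfolding sum_distrib_left[symmetric] by (rule mult_left_mono[OF g(2) Q0])
  finally show ?thesis by simp
qed

text \<open>
  The principle of local reflexivity in the case at hand: \<open>Q\<close> comes from a finite-rank
  operator of \<open>X\<close> into its bidual, which is replaced by one into \<open>X\<close> at the cost of \<open>\<epsilon>\<close> in norm. The distance
  bound provides \<open>F\<close> with small values on a finite net. Since \<open>F\<close> factors through \<open>base\<close>, its values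
  on the rest of the ball differ from these by at most \<open>\<delta> \<parallel>F\<parallel>\<close>, a term that can be absorbed.\<close>

lemma local_reflexivity_for_projections:
  assumes Q: "projection_onto dual_smul W D Q" and \<epsilon>: "0 < \<epsilon>"
  obtains F where "complementary F" "opnorm_on UNIV F \<le> opnorm_on D Q + \<epsilon>"
proof -
  define M where "M = opnorm_on D Q"
  have op: "bounded_operator_on dual_smul D Q" using Q by (simp add: projection_onto_def)
  have M0: "0 \<le> M" unfolding M_def by (rule dual.opnorm_on_nonneg[OF op subspace_D])
  \<comment> \<open>Chosen so that \<open>(M + \<epsilon>) (1 - \<delta>) = M + \<epsilon> / 2\<close>.\<close>
  define \<delta> where "\<delta> = \<epsilon> / (2 * (M + \<epsilon>))"
  have \<delta>: "0 < \<delta>" "\<delta> * (2 * (M + \<epsilon>)) = \<epsilon>" using \<epsilon> M0 by (auto simp: \<delta>_def)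
  define C where "C = 1 + (\<Sum>j\<in>J. norm (b j))"
  have C: "1 \<le> C" by (simp add: C_def sum_nonneg)
  have "0 < \<delta> / C" using \<delta>(1) C by simp
  then obtain A where A: "finite A" "A \<subseteq> cball 0 1"
    and net: "\<And>x. norm x \<le> 1 \<Longrightarrow> \<exists>a\<in>A. \<forall>j\<in>J. norm (blinfun_apply (f j) (x - a)) \<le> \<delta> / C"
    using finite_net_for_functionals[OF finite_J] by metis
  obtain as where as: "set as = A" using finite_list[OF A(1)] by blast
  define N where "N = length as"
  have as_le: "norm (as ! k) \<le> 1" if "k < N" for k
    using that A(2) as nth_mem[of k as] by (auto simp: N_def)
  have "\<exists>S. bounded_operator_on smul UNIV S \<and> (\<forall>y\<in>Y. S y = 0) \<and> (\<forall>x. S x \<in> Y) \<and>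
      norm (finite_sequence N (\<lambda>k. base (as ! k) + S (as ! k))) < M + \<epsilon> / 2"
  proof (rule ccontr)
    assume no: "\<not> ?thesis"
    have "M + \<epsilon> / 2 \<le> opnorm_on D Q"
    proof (rule distance_bound_from_projection[OF Q as_le])
      show "0 \<le> M + \<epsilon> / 2" using M0 \<epsilon> by simp
      show "M + \<epsilon> / 2 \<le> norm (finite_sequence N (\<lambda>k. base (as ! k) + S (as ! k)))"
        if "bounded_operator_on smul UNIV S" "\<forall>y\<in>Y. S y = 0" "\<forall>x. S x \<in> Y" for S
        using no that by (meson not_le)
    qed
    then show False using \<epsilon> by (simp add: M_def)
  qed
  then obtain S where S: "bounded_operator_on smul UNIV S" "\<And>y. y \<in> Y \<Longrightarrow> S y = 0" "\<And>x. S x \<in> Y"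
    and small: "norm (finite_sequence N (\<lambda>k. base (as ! k) + S (as ! k))) < M + \<epsilon> / 2" by blast
  define F where "F x = base x + S x" for x
  have F: "complementary F"
    unfolding F_def by (rule complementary_add[OF complementary_base S])
  then have op_F: "bounded_operator_on smul UNIV F" by (simp add: complementary_def)
  note bl_F = bounded_linear_of_bounded_operator[OF op_F]
  define c where "c = opnorm_on UNIV F"
  have c0: "0 \<le> c" unfolding c_def by (rule opnorm_on_nonneg[OF op_F subspace_UNIV])
  have F_le: "norm (F x) \<le> c * norm x" for x
    unfolding c_def by (rule norm_le_opnorm_on[OF op_F subspace_UNIV]) simp
  have F_A: "norm (F a) \<le> M + \<epsilon> / 2" if "a \<in> A" for a
  proof -
    from that as obtain k where k: "k < N" "a = as ! k" by (auto simp: in_set_conv_nth N_def)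
    then have "norm (F a) \<le> norm (finite_sequence N (\<lambda>k. base (as ! k) + S (as ! k)))"
      using norm_le_norm_finite_sequence[of k N "\<lambda>k. base (as ! k) + S (as ! k)"] by (simp add: F_def)
    with small show ?thesis by simp
  qed
  have F_ball: "norm (F x) \<le> M + \<epsilon> / 2 + c * \<delta>" if x: "norm x \<le> 1" for x
  proof -
    obtain a where a: "a \<in> A" "\<And>j. j \<in> J \<Longrightarrow> norm (blinfun_apply (f j) (x - a)) \<le> \<delta> / C"
      using net[OF x] by blast
    have "norm (base (x - a)) \<le> (\<Sum>j\<in>J. norm (blinfun_apply (f j) (x - a)) * norm (b j))"
      unfolding base_def by (rule order_trans[OF norm_sum]) (simp add: norm_smul)
    also have "\<dots> \<le> (\<Sum>j\<in>J. \<delta> / C * norm (b j))"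
      by (intro sum_mono mult_right_mono a) simp_all
    also have "\<dots> = \<delta> / C * (\<Sum>j\<in>J. norm (b j))" by (simp only: sum_distrib_left)
    also have "\<dots> \<le> \<delta> / C * C" using \<delta>(1) C by (intro mult_left_mono) (simp_all add: C_def)
    finally have "norm (base (x - a)) \<le> \<delta>" using C by simp
    then have "c * norm (base (x - a)) \<le> c * \<delta>" using c0 by (rule mult_left_mono)
    with F_le[of "base (x - a)"] have 1: "norm (F (x - a)) \<le> c * \<delta>"
      by (simp add: complementary_apply(1)[OF F])
    have "F x = F a + F (x - a)" by (simp add: linear_diff[OF bounded_linear.linear[OF bl_F]])
    then have "norm (F x) \<le> norm (F a) + norm (F (x - a))" using norm_triangle_ineq by metis
    with 1 F_A[OF a(1)] show ?thesis by simp
  qed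
  have "c \<le> M + \<epsilon> / 2 + c * \<delta>"
    unfolding c_def opnorm_on_UNIV[OF op_F]
    by (rule norm_blinfun_le_on_unit_ball)
       (use F_ball in \<open>simp add: bounded_linear_Blinfun_apply[OF bl_F] c_def opnorm_on_UNIV[OF op_F]\<close>)
  then have "c * (1 - \<delta>) \<le> M + \<epsilon> / 2" by (simp add: algebra_simps)
  also have "M + \<epsilon> / 2 = (M + \<epsilon>) * (1 - \<delta>)" using \<delta>(2) by (simp add: algebra_simps)
  finally have le: "c * (1 - \<delta>) \<le> (M + \<epsilon>) * (1 - \<delta>)" .
  have "\<delta> < 1" using \<epsilon> M0 by (simp add: \<delta>_def)
  with le have "c \<le> M + \<epsilon>" by simp
  with F show ?thesis by (intro that) (simp_all add: c_def M_def)
qed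

end

section \<open>Minimal projections\<close>

context biorthogonal_system begin

lemma projection_onto_Y_norm:
  assumes daugavet: "daugavet_property smul" "J \<noteq> {}" and P: "projection_onto smul Y UNIV P"
  shows "opnorm_on UNIV P = 1 + opnorm_on D (adjoint_operator smul (\<lambda>x. x - P x))"
proof -
  have F: "complementary (\<lambda>x. x - P x)" using P by (simp add: projection_onto_Y_iff)
  then have "bounded_operator_on smul UNIV (\<lambda>x. x - P x)" by (simp add: complementary_def)
  then show ?thesis
    using opnorm_on_id_minus_complementary[OF daugavet F] by (simp add: opnorm_on_adjoint)
qed

text \<open>
  Projections onto \<open>Y\<close> yield only weak*-continuous projections onto \<open>W\<close>, which gives one inequality
  directly; the other one is local reflexivity.\<close>

lemma projection_constant_Y:
  assumes daugavet: "daugavet_property smul" "J \<noteq> {}"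
  shows "projection_constant smul Y UNIV = 1 + projection_constant dual_smul W D"
proof (rule antisym)
  let ?\<mu> = "projection_constant dual_smul W D"
  have \<mu>_le: "?\<mu> \<le> ereal (opnorm_on D Q)" if "projection_onto dual_smul W D Q" for Q
    unfolding projection_constant_def using that by (intro INF_lower) simp
  show "1 + ?\<mu> \<le> projection_constant smul Y UNIV"
    unfolding projection_constant_def[of smul]
  proof (rule INF_greatest)
    fix P assume "P \<in> {P. projection_onto smul Y UNIV P}"
    then have P: "projection_onto smul Y UNIV P" by simp
    then have "projection_onto dual_smul W D (adjoint_operator smul (\<lambda>x. x - P x))"
      by (simp add: projection_onto_Y_iff projection_onto_adjoint)
    then have "1 + ?\<mu> \<le> 1 + ereal (opnorm_on D (adjoint_operator smul (\<lambda>x. x - P x)))"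
      by (intro add_left_mono \<mu>_le)
    also have "\<dots> = ereal (opnorm_on UNIV P)"
      by (simp add: projection_onto_Y_norm[OF daugavet P] one_ereal_def)
    finally show "1 + ?\<mu> \<le> ereal (opnorm_on UNIV P)" .
  qed
  have "projection_constant smul Y UNIV \<le> ereal (1 + opnorm_on D Q)"
    if Q: "projection_onto dual_smul W D Q" for Q
  proof (rule ereal_le_epsilon2)
    fix \<epsilon> :: real assume "0 < \<epsilon>"
    then obtain F where F: "complementary F" "opnorm_on UNIV F \<le> opnorm_on D Q + \<epsilon>"
      using local_reflexivity_for_projections[OF Q] by blast
    have "projection_onto smul Y UNIV (\<lambda>x. x - F x)" using F(1) by (simp add: projection_onto_Y_iff)
    then have "projection_constant smul Y UNIV \<le> ereal (opnorm_on UNIV (\<lambda>x. x - F x))"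
      unfolding projection_constant_def by (intro INF_lower) simp
    also have "\<dots> \<le> ereal (1 + opnorm_on D Q) + ereal \<epsilon>"
      using F(2) by (simp add: opnorm_on_id_minus_complementary[OF daugavet F(1)])
    finally show "projection_constant smul Y UNIV \<le> ereal (1 + opnorm_on D Q) + ereal \<epsilon>" .
  qed
  then have "projection_constant smul Y UNIV - 1 \<le> ?\<mu>"
    unfolding projection_constant_def[of dual_smul]
    by (intro INF_greatest) (simp add: ereal_minus_le one_ereal_def add.commute)
  then show "projection_constant smul Y UNIV \<le> 1 + ?\<mu>"
    by (simp add: ereal_minus_le add.commute)
qed

text \<open>
  The correspondence shifts norms by 1, as do the two projection constants, so it preserves
  minimality. It is injective because the dual space separates points.\<close>

lemma bij_betw_minimal_projections:
  assumes daugavet: "daugavet_property smul" "J \<noteq> {}"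
  shows "bij_betw (\<lambda>P. adjoint_operator smul (\<lambda>x. x - P x))
    {P. minimal_projection smul Y UNIV P}
    {Q. minimal_projection dual_smul W D Q \<and>
        continuous_map (weak_star_topology smul) (top_of_set W) Q}"
  (is "bij_betw ?A ?Ps ?Qs")
proof -
  have minimal_iff: "minimal_projection smul Y UNIV P \<longleftrightarrow> minimal_projection dual_smul W D (?A P)"
    if P: "projection_onto smul Y UNIV P" for P
  proof -
    have "projection_onto dual_smul W D (?A P)"
      using P by (simp add: projection_onto_Y_iff projection_onto_adjoint)
    moreover have "ereal (opnorm_on UNIV P) = 1 + ereal (opnorm_on D (?A P))"
      by (simp add: projection_onto_Y_norm[OF daugavet P] one_ereal_def)
    ultimately show ?thesis
      using P by (cases "projection_constant dual_smul W D")
        (simp_all add: minimal_projection_def projection_constant_Y[OF daugavet] one_ereal_def)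
  qed
  have inj: "P = P'" if P: "projection_onto smul Y UNIV P" and P': "projection_onto smul Y UNIV P'"
    and eq: "?A P = ?A P'" for P P'
  proof
    fix x
    have op: "bounded_operator_on smul UNIV (\<lambda>x. x - R x)" if "projection_onto smul Y UNIV R" for R
      using that by (simp add: projection_onto_Y_iff complementary_def)
    have "x - P x = x - P' x"
    proof (rule dual_space_separates_points)
      fix g assume g: "g \<in> D"
      show "blinfun_apply g (x - P x) = blinfun_apply g (x - P' x)"
        using arg_cong[OF eq, of "\<lambda>Q. blinfun_apply (Q g) x"]
        by (simp add: adjoint_operator_apply[OF normed_space_over_axioms op[OF P] g]
            adjoint_operator_apply[OF normed_space_over_axioms op[OF P'] g])
    qed
    then show "P x = P' x" by simp
  qed
  show ?thesis
    unfolding bij_betw_def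
  proof (intro conjI subset_antisym)
    show "inj_on ?A ?Ps" using inj by (auto simp: inj_on_def minimal_projection_def)
    show "?A ` ?Ps \<subseteq> ?Qs"
    proof (rule image_subsetI, rule CollectI)
      fix P assume "P \<in> ?Ps"
      then have min: "minimal_projection smul Y UNIV P" by simp
      then have P: "projection_onto smul Y UNIV P" by (simp add: minimal_projection_def)
      then have "complementary (\<lambda>x. x - P x)" by (simp add: projection_onto_Y_iff)
      with min show "minimal_projection dual_smul W D (?A P) \<and>
          continuous_map (weak_star_topology smul) (top_of_set W) (?A P)"
        using minimal_iff[OF P] weak_star_continuous_adjoint by blast
    qed
    show "?Qs \<subseteq> ?A ` ?Ps"
    proof
      fix Q assume "Q \<in> ?Qs"
      then have Q: "minimal_projection dual_smul W D Q" "projection_onto dual_smul W D Q"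
        and cont: "continuous_map (weak_star_topology smul) (top_of_set W) Q"
        by (simp_all add: minimal_projection_def)
      obtain F where F: "complementary F" "adjoint_operator smul F = Q"
        by (rule weak_star_continuous_projection_is_adjoint[OF Q(2) cont])
      have P: "projection_onto smul Y UNIV (\<lambda>x. x - F x)" using F(1) by (simp add: projection_onto_Y_iff)
      have A: "Q = ?A (\<lambda>x. x - F x)" using F(2) by simp
      have "(\<lambda>x. x - F x) \<in> ?Ps" using minimal_iff[OF P] Q(1) by (simp add: F(2))
      then show "Q \<in> ?A ` ?Ps"
        by (rule image_eqI[where f = ?A and x = "\<lambda>x. x - F x", OF A])
    qed
  qed
qed

end

theorem theorem3p1:
  fixes smul :: "'k::real_or_complex \<Rightarrow> 'a::banach \<Rightarrow> 'a"
    and n :: nat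
    and f :: "nat \<Rightarrow> 'a \<Rightarrow>\<^sub>L 'k"
    and Y :: "'a set"
    and W :: "('a \<Rightarrow>\<^sub>L 'k) set"
  assumes "normed_space_over smul"
    and "daugavet_property smul"
    and "n \<ge> 1"
    and "\<And>j. j \<in> {1..n} \<Longrightarrow> f j \<in> dual_space smul"
    and "inj_on f {1..n}" and "dual.independent (f ` {1..n})"
    and "Y = (\<Inter>j\<in>{1..n}. {x. blinfun_apply (f j) x = 0})"
    and "W = dual.span (f ` {1..n})"
  shows "projection_constant smul Y UNIV = 1 + projection_constant dual_smul W (dual_space smul)
    \<and> ((\<exists>P. minimal_projection smul Y UNIV P) \<longleftrightarrow>
       (\<exists>Q. minimal_projection dual_smul W (dual_space smul) Q \<and>
            continuous_map (weak_star_topology smul) (top_of_set W) Q))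
    \<and> bij_betw (\<lambda>P. adjoint_operator smul (\<lambda>x. x - P x))
        {P. minimal_projection smul Y UNIV P}
        {Q. minimal_projection dual_smul W (dual_space smul) Q \<and>
            continuous_map (weak_star_topology smul) (top_of_set W) Q}"
proof -
  interpret normed_space_over smul by fact
  obtain b where b: "\<And>i j. i \<in> {1..n} \<Longrightarrow> j \<in> {1..n} \<Longrightarrow>
      blinfun_apply (f i) (b j) = (if i = j then 1 else 0)"
    using biorthogonal_vectors_exist[of "{1..n}" f] assms(4-6) by auto
  interpret B: biorthogonal_system smul "{1..n}" f b
    by unfold_locales (simp, fact assms(4), fact b)
  have YW: "Y = B.Y" "W = B.W" unfolding B.Y_def B.W_def by fact+
  have ne: "{1..n} \<noteq> {}" using \<open>n \<ge> 1\<close> by simp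
  note bij = B.bij_betw_minimal_projections[OF assms(2) ne]
  have "{P. minimal_projection smul B.Y UNIV P} = {} \<longleftrightarrow>
      {Q. minimal_projection dual_smul B.W (dual_space smul) Q \<and>
        continuous_map (weak_star_topology smul) (top_of_set B.W) Q} = {}"
    by (subst bij_betw_imp_surj_on[OF bij, symmetric]) (rule image_is_empty[symmetric])
  then have "(\<exists>P. minimal_projection smul B.Y UNIV P) \<longleftrightarrow>
      (\<exists>Q. minimal_projection dual_smul B.W (dual_space smul) Q \<and>
        continuous_map (weak_star_topology smul) (top_of_set B.W) Q)"
    unfolding Collect_empty_eq by blast
  then show ?thesis
    unfolding YW by (intro conjI bij B.projection_constant_Y[OF assms(2) ne])
qed

end
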